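(* Let $V=(V,\le,\otimes,k)$ be a set-sized commutative unital quantale: $V$ is a complete lattice, and $\otimes$ is associative, commutative, has unit $k$, and preserves arbitrary joins in each variable. Let $V\text{-}\mathbf{Cat}$ have as objects sets $X$ with functions $a:X\times X\to V$ satisfying $$k\le a(x,x),\qquad a(x,y)\otimes a(y,z)\le a(x,z)$$ for all $x,y,z\in X$, and as morphisms functions $f:(X,a)\to(Y,b)$ satisfying $a(x,y)\le b(fx,fy)$ for all $x,y$. No separation condition is imposed. Then both $V\text{-}\mathbf{Cat}$ and its full subcategory of symmetric objects, for which $a(x,y)=a(y,x)$, admit noetherian forms inducing the factorization system of surjective morphisms (left class) and injective fully faithful morphisms (right class), where fully faithful means $a(x,y)=b(fx,fy)$ for every $x,y$.
   Context: Conventions: categories are locally small; "set" is relative to a fixed universe. A proper factorization system $(\mathcal E,\mathcal M)$ is an orthogonal factorization system with every morphism in $\mathcal E$ an epimorphism and every morphism in $\mathcal M$ a monomorphism. Forms. An (orean) form $\mathsf F$ on a category $\mathcal C$ assigns to each object $X$ a set-sized bounded lattice $\mathsf F(X)$ (the fibre over $X$; its elements are called clusters) and to each morphism $f:X\to Y$ monotone maps $f_!:\mathsf F(X)\to\mathsf F(Y)$ and $f^*:\mathsf F(Y)\to\mathsf F(X)$ with $f_!S\le T\iff S\le f^*T$, such that $(gf)_!=g_!f_!$, $(gf)^*=f^*g^*$, and identities act as identities. Put $\operatorname{Im}f=f_!\top_X$ and $\operatorname{Ker}f=f^*\bot_Y$. A cluster in $\mathsf F(X)$ is conormal if it is the image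 of some morphism of $\mathcal C$ with codomain $X$, and normal if it is the kernel of some morphism of $\mathcal C$ with domain $X$. An embedding of a conormal $S\in\mathsf F(X)$ is a morphism $\iota$ into $X$ with $\operatorname{Im}\iota=S$ such that every morphism $f$ into $X$ with $\operatorname{Im}f\le S$ factors as $f=\iota h$ for a unique $h$. A quotient of a normal $K\in\mathsf F(X)$ is a morphism $\pi$ out of $X$ with $\operatorname{Ker}\pi=K$ such that every morphism $g$ out of $X$ with $K\le\operatorname{Ker}g$ factors as $g=h\pi$ for a unique $h$. The form is noetherian if: (N1) $f^*f_!S=S\vee\operatorname{Ker}f$ and $f_!f^*T=T\wedge\operatorname{Im}f$ for all $f,S,T$; (N2) every morphism $f$ factors as $f=me$ with $e$ a quotient of $\operatorname{Ker}f$ and $m$ an embedding of $\operatorname{Im}f$; (N3) the join of two normal clusters (in the same fibre) is normal, and the meet of two conormal clusters is conormal. For a noetherian form, the class of all quotients (of normal clusters) and the class of all embeddings (of conormal clusters) form a proper factorization system, the one induced by the form (quotients as left class, embeddings as right class). *)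

theory Defs
  imports "HOL-Algebra.Lattice" "HOL-Library.Equipollence" "HOL-Library.FuncSet"
begin

section \<open>The fixed universe of sets\<close>

text \<open>
  A Grothendieck universe is modelled by a type: a subset of it counts as a set of the universe
  iff it is strictly smaller than the whole type. The axioms say that the cardinality of the type
  is infinite, a strong limit and regular. For an inaccessible cardinal \<open>\<kappa>\<close> the subsets of
  \<open>V\<^sub>\<kappa>\<close> of cardinality less than \<open>\<kappa>\<close> are exactly the elements of
  \<open>V\<^sub>\<kappa>\<close>. The universe of hereditarily finite sets is allowed as well.
\<close>

class universe =
  assumes infinite_universe: "infinite (UNIV :: 'a set)"
    and universe_Pow:
      "(X :: 'a set) \<prec> (UNIV :: 'a set) \<Longrightarrow> Pow X \<prec> (UNIV :: 'a set)"
    and universe_Union: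
      "(I :: 'a set) \<prec> (UNIV :: 'a set) \<Longrightarrow> (\<And>i. i \<in> I \<Longrightarrow> Y i \<prec> (UNIV :: 'a set))
        \<Longrightarrow> (\<Union>i\<in>I. (Y i :: 'a set)) \<prec> (UNIV :: 'a set)"

text \<open>The axioms are satisfiable in HOL; here the small sets are the finite ones.\<close>

instance nat :: universe
proof -
  have small: "A \<prec> (UNIV :: nat set) \<longleftrightarrow> finite A" for A :: "'b set"
  proof
    assume "A \<prec> (UNIV :: nat set)"
    then show "finite A"
      using infinite_le_lepoll[of A] unfolding lesspoll_def
      by (meson lepoll_antisym)
  qed (simp add: finite_lesspoll_infinite)
  show "OFCLASS(nat, universe_class)"
    by standard (auto simp: small)
qed


section \<open>Categories\<close>

record ('o, 'm) category =
  Ob :: "'o set"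
  Mor :: "'m set"
  Dom :: "'m \<Rightarrow> 'o"
  Cod :: "'m \<Rightarrow> 'o"
  Id :: "'o \<Rightarrow> 'm"
  Comp :: "'m \<Rightarrow> 'm \<Rightarrow> 'm"  (infixl \<open>\<cdot>\<index>\<close> 70)

definition Hom :: "('o, 'm) category \<Rightarrow> 'o \<Rightarrow> 'o \<Rightarrow> 'm set" where
  "Hom C X Y = {f \<in> Mor C. Dom C f = X \<and> Cod C f = Y}"

locale category =
  fixes C :: "('o, 'm) category" (structure)
  assumes Dom_in_Ob: "f \<in> Mor C \<Longrightarrow> Dom C f \<in> Ob C"
    and Cod_in_Ob: "f \<in> Mor C \<Longrightarrow> Cod C f \<in> Ob C"
    and Id_in_Hom: "X \<in> Ob C \<Longrightarrow> Id C X \<in> Hom C X X"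
    and Comp_in_Hom: "\<lbrakk>f \<in> Hom C X Y; g \<in> Hom C Y Z\<rbrakk> \<Longrightarrow> g \<cdot> f \<in> Hom C X Z"
    and Comp_Id: "f \<in> Mor C \<Longrightarrow> f \<cdot> Id C (Dom C f) = f"
    and Id_Comp: "f \<in> Mor C \<Longrightarrow> Id C (Cod C f) \<cdot> f = f"
    and Comp_assoc:
      "\<lbrakk>f \<in> Hom C W X; g \<in> Hom C X Y; h \<in> Hom C Y Z\<rbrakk> \<Longrightarrow> (h \<cdot> g) \<cdot> f = h \<cdot> (g \<cdot> f)"

definition full_subcategory ::
    "('o, 'm) category \<Rightarrow> ('o \<Rightarrow> bool) \<Rightarrow> ('o, 'm) category" where
  "full_subcategory C P =
    C\<lparr>Ob := {X \<in> Ob C. P X}, Mor := {f \<in> Mor C. P (Dom C f) \<and> P (Cod C f)}\<rparr>"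

definition epimorphisms :: "('o, 'm) category \<Rightarrow> 'm set" where
  "epimorphisms C = {f \<in> Mor C. \<forall>Z. \<forall>g\<in>Hom C (Cod C f) Z. \<forall>h\<in>Hom C (Cod C f) Z.
     g \<cdot>\<^bsub>C\<^esub> f = h \<cdot>\<^bsub>C\<^esub> f \<longrightarrow> g = h}"

definition monomorphisms :: "('o, 'm) category \<Rightarrow> 'm set" where
  "monomorphisms C = {f \<in> Mor C. \<forall>Z. \<forall>g\<in>Hom C Z (Dom C f). \<forall>h\<in>Hom C Z (Dom C f).
     f \<cdot>\<^bsub>C\<^esub> g = f \<cdot>\<^bsub>C\<^esub> h \<longrightarrow> g = h}"

definition isomorphisms :: "('o, 'm) category \<Rightarrow> 'm set" where
  "isomorphisms C = {f \<in> Mor C. \<exists>g\<in>Hom C (Cod C f) (Dom C f).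
     g \<cdot>\<^bsub>C\<^esub> f = Id C (Dom C f) \<and> f \<cdot>\<^bsub>C\<^esub> g = Id C (Cod C f)}"

locale orthogonal_factorization_system = category C
  for C :: "('o, 'm) category" (structure) +
  fixes E M :: "'m set"
  assumes left_subset: "E \<subseteq> Mor C" and right_subset: "M \<subseteq> Mor C"
    and left_isos: "isomorphisms C \<subseteq> E" and right_isos: "isomorphisms C \<subseteq> M"
    and left_Comp: "\<lbrakk>f \<in> E; g \<in> E; Cod C f = Dom C g\<rbrakk> \<Longrightarrow> g \<cdot> f \<in> E"
    and right_Comp: "\<lbrakk>f \<in> M; g \<in> M; Cod C f = Dom C g\<rbrakk> \<Longrightarrow> g \<cdot> f \<in> M"
    and factorization:
      "f \<in> Mor C \<Longrightarrow> \<exists>e\<in>E. \<exists>m\<in>M. Cod C e = Dom C m \<and> f = m \<cdot> e"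
    and diagonal:
      "\<lbrakk>e \<in> E; m \<in> M; u \<in> Hom C (Dom C e) (Dom C m); v \<in> Hom C (Cod C e) (Cod C m);
        v \<cdot> e = m \<cdot> u\<rbrakk>
       \<Longrightarrow> \<exists>!d. d \<in> Hom C (Cod C e) (Dom C m) \<and> d \<cdot> e = u \<and> m \<cdot> d = v"

locale proper_factorization_system = orthogonal_factorization_system +
  assumes left_epi: "E \<subseteq> epimorphisms C" and right_mono: "M \<subseteq> monomorphisms C"


section \<open>Noetherian forms\<close>

record ('o, 'm, 'c) form =
  Fib :: "'o \<Rightarrow> 'c gorder"
  push :: "'m \<Rightarrow> 'c \<Rightarrow> 'c"
  pull :: "'m \<Rightarrow> 'c \<Rightarrow> 'c"

text \<open>
  Clusters are elements of the universe, and every fibre is a set of the universe.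
  The convention that categories are locally small relative to the universe is made explicit here.
\<close>

locale form = category C
  for C :: "('o, 'm) category" (structure) +
  fixes F :: "('o, 'm, 'c :: universe) form"
  assumes locally_small:
      "\<lbrakk>X \<in> Ob C; Y \<in> Ob C\<rbrakk> \<Longrightarrow> Hom C X Y \<prec> (UNIV :: 'c set)"
    and fibre_small: "X \<in> Ob C \<Longrightarrow> carrier (Fib F X) \<prec> (UNIV :: 'c set)"
    and fibre_lattice: "X \<in> Ob C \<Longrightarrow> bounded_lattice (Fib F X)"
    and push_closed:
      "f \<in> Hom C X Y \<Longrightarrow> push F f \<in> carrier (Fib F X) \<rightarrow> carrier (Fib F Y)"
    and pull_closed:
      "f \<in> Hom C X Y \<Longrightarrow> pull F f \<in> carrier (Fib F Y) \<rightarrow> carrier (Fib F X)"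
    and push_mono: "f \<in> Hom C X Y \<Longrightarrow> isotone (Fib F X) (Fib F Y) (push F f)"
    and pull_mono: "f \<in> Hom C X Y \<Longrightarrow> isotone (Fib F Y) (Fib F X) (pull F f)"
    and adjunction:
      "\<lbrakk>f \<in> Hom C X Y; S \<in> carrier (Fib F X); T \<in> carrier (Fib F Y)\<rbrakk>
       \<Longrightarrow> push F f S \<sqsubseteq>\<^bsub>Fib F Y\<^esub> T \<longleftrightarrow> S \<sqsubseteq>\<^bsub>Fib F X\<^esub> pull F f T"
    and push_Comp:
      "\<lbrakk>f \<in> Hom C X Y; g \<in> Hom C Y Z; S \<in> carrier (Fib F X)\<rbrakk>
       \<Longrightarrow> push F (g \<cdot> f) S = push F g (push F f S)"
    and pull_Comp:
      "\<lbrakk>f \<in> Hom C X Y; g \<in> Hom C Y Z; T \<in> carrier (Fib F Z)\<rbrakk>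
       \<Longrightarrow> pull F (g \<cdot> f) T = pull F f (pull F g T)"
    and push_Id:
      "\<lbrakk>X \<in> Ob C; S \<in> carrier (Fib F X)\<rbrakk> \<Longrightarrow> push F (Id C X) S = S"
    and pull_Id:
      "\<lbrakk>X \<in> Ob C; S \<in> carrier (Fib F X)\<rbrakk> \<Longrightarrow> pull F (Id C X) S = S"

definition Img :: "('o, 'm) category \<Rightarrow> ('o, 'm, 'c) form \<Rightarrow> 'm \<Rightarrow> 'c" where
  "Img C F f = push F f \<top>\<^bsub>Fib F (Dom C f)\<^esub>"

definition Ker :: "('o, 'm) category \<Rightarrow> ('o, 'm, 'c) form \<Rightarrow> 'm \<Rightarrow> 'c" where
  "Ker C F f = pull F f \<bottom>\<^bsub>Fib F (Cod C f)\<^esub>"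

definition conormal ::
    "('o, 'm) category \<Rightarrow> ('o, 'm, 'c) form \<Rightarrow> 'o \<Rightarrow> 'c \<Rightarrow> bool" where
  "conormal C F X S \<longleftrightarrow> (\<exists>f\<in>Mor C. Cod C f = X \<and> Img C F f = S)"

definition normal ::
    "('o, 'm) category \<Rightarrow> ('o, 'm, 'c) form \<Rightarrow> 'o \<Rightarrow> 'c \<Rightarrow> bool" where
  "normal C F X K \<longleftrightarrow> (\<exists>f\<in>Mor C. Dom C f = X \<and> Ker C F f = K)"

definition embedding_of ::
    "('o, 'm) category \<Rightarrow> ('o, 'm, 'c) form \<Rightarrow> 'o \<Rightarrow> 'c \<Rightarrow> 'm \<Rightarrow> bool" where
  "embedding_of C F X S i \<longleftrightarrow>
     conormal C F X S \<and> i \<in> Mor C \<and> Cod C i = X \<and> Img C F i = S \<and>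
     (\<forall>f\<in>Mor C. Cod C f = X \<and> Img C F f \<sqsubseteq>\<^bsub>Fib F X\<^esub> S \<longrightarrow>
        (\<exists>!h. h \<in> Hom C (Dom C f) (Dom C i) \<and> f = i \<cdot>\<^bsub>C\<^esub> h))"

definition quotient_of ::
    "('o, 'm) category \<Rightarrow> ('o, 'm, 'c) form \<Rightarrow> 'o \<Rightarrow> 'c \<Rightarrow> 'm \<Rightarrow> bool" where
  "quotient_of C F X K p \<longleftrightarrow>
     normal C F X K \<and> p \<in> Mor C \<and> Dom C p = X \<and> Ker C F p = K \<and>
     (\<forall>g\<in>Mor C. Dom C g = X \<and> K \<sqsubseteq>\<^bsub>Fib F X\<^esub> Ker C F g \<longrightarrow>
        (\<exists>!h. h \<in> Hom C (Cod C p) (Cod C g) \<and> g = h \<cdot>\<^bsub>C\<^esub> p))"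

definition embeddings :: "('o, 'm) category \<Rightarrow> ('o, 'm, 'c) form \<Rightarrow> 'm set" where
  "embeddings C F = {i. \<exists>X\<in>Ob C. \<exists>S\<in>carrier (Fib F X). embedding_of C F X S i}"

definition quotients :: "('o, 'm) category \<Rightarrow> ('o, 'm, 'c) form \<Rightarrow> 'm set" where
  "quotients C F = {p. \<exists>X\<in>Ob C. \<exists>K\<in>carrier (Fib F X). quotient_of C F X K p}"

locale noetherian_form = form +
  assumes pull_push:
      "\<lbrakk>f \<in> Hom C X Y; S \<in> carrier (Fib F X)\<rbrakk>
       \<Longrightarrow> pull F f (push F f S) = S \<squnion>\<^bsub>Fib F X\<^esub> Ker C F f"
    and push_pull:
      "\<lbrakk>f \<in> Hom C X Y; T \<in> carrier (Fib F Y)\<rbrakk>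
       \<Longrightarrow> push F f (pull F f T) = T \<sqinter>\<^bsub>Fib F Y\<^esub> Img C F f"
    and quotient_embedding_factorization:
      "f \<in> Hom C X Y \<Longrightarrow> \<exists>e m. quotient_of C F X (Ker C F f) e
         \<and> embedding_of C F Y (Img C F f) m \<and> Cod C e = Dom C m \<and> f = m \<cdot> e"
    and normal_join:
      "\<lbrakk>X \<in> Ob C; normal C F X K; normal C F X L\<rbrakk>
       \<Longrightarrow> normal C F X (K \<squnion>\<^bsub>Fib F X\<^esub> L)"
    and conormal_meet:
      "\<lbrakk>X \<in> Ob C; conormal C F X S; conormal C F X T\<rbrakk>
       \<Longrightarrow> conormal C F X (S \<sqinter>\<^bsub>Fib F X\<^esub> T)"

definition induces ::
    "('o, 'm) category \<Rightarrow> ('o, 'm, 'c) form \<Rightarrow> 'm set \<Rightarrow> 'm set \<Rightarrow> bool" where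
  "induces C F E M \<longleftrightarrow>
     proper_factorization_system C E M \<and> quotients C F = E \<and> embeddings C F = M"


section \<open>Quantale-enriched categories\<close>

locale commutative_unital_quantale = comm_monoid tensor k
  for tensor :: "'v :: complete_lattice \<Rightarrow> 'v \<Rightarrow> 'v"  (infixl \<open>\<otimes>\<close> 70) and k :: 'v +
  assumes tensor_Sup: "x \<otimes> Sup A = (SUP y\<in>A. x \<otimes> y)"
    and Sup_tensor: "Sup A \<otimes> y = (SUP x\<in>A. x \<otimes> y)"

record ('u, 'v) vcat =
  pts :: "'u set"
  vhom :: "'u \<times> 'u \<Rightarrow> 'v"

record ('u, 'v) vfunctor =
  src :: "('u, 'v) vcat"
  tgt :: "('u, 'v) vcat"
  fn :: "'u \<Rightarrow> 'u"

text \<open>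
  Functions on a set are extensional (\<open>\<rightarrow>\<^sub>E\<close>), so that equality of objects and of
  morphisms is the set-theoretic one.
\<close>

definition is_vcat ::
    "('v :: complete_lattice \<Rightarrow> 'v \<Rightarrow> 'v) \<Rightarrow> 'v \<Rightarrow> ('u :: universe, 'v) vcat \<Rightarrow> bool" where
  "is_vcat tensor k A \<longleftrightarrow>
     pts A \<prec> (UNIV :: 'u set) \<and>
     vhom A \<in> pts A \<times> pts A \<rightarrow>\<^sub>E UNIV \<and>
     (\<forall>x\<in>pts A. k \<le> vhom A (x, x)) \<and>
     (\<forall>x\<in>pts A. \<forall>y\<in>pts A. \<forall>z\<in>pts A.
        tensor (vhom A (x, y)) (vhom A (y, z)) \<le> vhom A (x, z))"

definition is_vfunctor ::
    "('v :: complete_lattice \<Rightarrow> 'v \<Rightarrow> 'v) \<Rightarrow> 'v \<Rightarrow> ('u :: universe, 'v) vfunctor \<Rightarrow> bool" where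
  "is_vfunctor tensor k f \<longleftrightarrow>
     is_vcat tensor k (src f) \<and> is_vcat tensor k (tgt f) \<and>
     fn f \<in> pts (src f) \<rightarrow>\<^sub>E pts (tgt f) \<and>
     (\<forall>x\<in>pts (src f). \<forall>y\<in>pts (src f). vhom (src f) (x, y) \<le> vhom (tgt f) (fn f x, fn f y))"

definition V_Cat ::
    "('v :: complete_lattice \<Rightarrow> 'v \<Rightarrow> 'v) \<Rightarrow> 'v
      \<Rightarrow> (('u :: universe, 'v) vcat, ('u, 'v) vfunctor) category" where
  "V_Cat tensor k =
     \<lparr>Ob = {A. is_vcat tensor k A},
      Mor = {f. is_vfunctor tensor k f},
      Dom = src,
      Cod = tgt,
      Id = (\<lambda>A. \<lparr>src = A, tgt = A, fn = (\<lambda>x\<in>pts A. x)\<rparr>),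
      Comp = (\<lambda>g f. \<lparr>src = src f, tgt = tgt g, fn = compose (pts (src f)) (fn g) (fn f)\<rparr>)\<rparr>"

definition symmetric_vcat :: "('u, 'v) vcat \<Rightarrow> bool" where
  "symmetric_vcat A \<longleftrightarrow> (\<forall>x\<in>pts A. \<forall>y\<in>pts A. vhom A (x, y) = vhom A (y, x))"

definition Sym_V_Cat ::
    "('v :: complete_lattice \<Rightarrow> 'v \<Rightarrow> 'v) \<Rightarrow> 'v
      \<Rightarrow> (('u :: universe, 'v) vcat, ('u, 'v) vfunctor) category" where
  "Sym_V_Cat tensor k = full_subcategory (V_Cat tensor k) symmetric_vcat"

definition surjective :: "('u, 'v) vfunctor \<Rightarrow> bool" where
  "surjective f \<longleftrightarrow> fn f ` pts (src f) = pts (tgt f)"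

definition injective :: "('u, 'v) vfunctor \<Rightarrow> bool" where
  "injective f \<longleftrightarrow> inj_on (fn f) (pts (src f))"

definition fully_faithful :: "('u, 'v) vfunctor \<Rightarrow> bool" where
  "fully_faithful f \<longleftrightarrow>
     (\<forall>x\<in>pts (src f). \<forall>y\<in>pts (src f). vhom (src f) (x, y) = vhom (tgt f) (fn f x, fn f y))"

end

theory Submission
  imports Defs
begin

text \<open>
  A cluster over \<open>(X, a)\<close> consists of a set of marked points of \<open>X\<close> and, for every subset
  \<open>B\<close> of \<open>X\<close>, an equivalence relation on \<open>B\<close> together with an invariant \<open>V\<close>-category
  structure on \<open>B\<close> above \<open>a\<close>; clusters are ordered by inclusion. Structure over \<open>B\<close> restricts to
  smaller sets, and it extends from \<open>C\<close> to \<open>B\<close> as soon as every point of \<open>B\<close> is glued to a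
  point of \<open>C\<close>. A kernel is determined by its part over \<open>X\<close>: the equivalence relation
  \<open>f x = f y\<close> and the structure pulled back along \<open>f\<close>, so that every surjective
  functor is the quotient of its kernel. The image of \<open>f\<close> is full on the subsets of the range of
  \<open>f\<close>, trivial on all other sets, and marks the range.

  A single structure over \<open>X\<close> would not do: an embedding \<open>A \<rightarrow> X\<close> has to identify the clusters
  over \<open>A\<close> with those below its image, whereas structure added on \<open>A\<close> and then completed by
  transitivity leaks out of \<open>A\<close>. The extension axiom, on the other hand, makes a surjection \<open>f\<close>
  identify the clusters over its target with those above its kernel.
\<close>


section \<open>Small sets\<close>

lemma lesspoll_image_iff:
  fixes A :: "'b set"
  assumes "inj_on f A"
  shows "f ` A \<prec> (UNIV :: 'u set) \<longleftrightarrow> A \<prec> (UNIV :: 'u set)"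
  by (meson assms eqpoll_sym inj_on_image_eqpoll_self lesspoll_trans1 eqpoll_imp_lepoll)

text \<open>The axioms of a universe speak only of subsets of \<open>'u\<close>, so \<open>A\<close>
  is first carried into \<open>'u\<close> by an injection.\<close>

lemma small_Pow:
  fixes A :: "'b set"
  assumes "A \<prec> (UNIV :: 'u :: universe set)"
  shows "Pow A \<prec> (UNIV :: 'u set)"
proof -
  obtain f :: "'b \<Rightarrow> 'u" where f: "inj_on f A"
    using assms by (auto simp: lesspoll_def lepoll_def)
  then have "Pow (f ` A) \<prec> (UNIV :: 'u set)"
    using assms lesspoll_image_iff universe_Pow by blast
  moreover have "(`) f ` Pow A \<subseteq> Pow (f ` A)"
    by auto
  ultimately have "(`) f ` Pow A \<prec> (UNIV :: 'u set)"
    by (meson lesspoll_trans1 subset_imp_lepoll)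
  then show ?thesis
    using lesspoll_image_iff[OF inj_on_image_Pow[OF f]] by blast
qed

text \<open>An infinite set is equipollent to its square, which gives a pairing on
  \<open>'u\<close>. The product then becomes a union of small slices over a small index set, and
  regularity applies.\<close>

lemma small_Times:
  fixes A :: "'b set" and B :: "'c set"
  assumes "A \<prec> (UNIV :: 'u :: universe set)" "B \<prec> (UNIV :: 'u set)"
  shows "A \<times> B \<prec> (UNIV :: 'u set)"
proof -
  obtain f :: "'b \<Rightarrow> 'u" and g :: "'c \<Rightarrow> 'u" where f: "inj_on f A" and g: "inj_on g B"
    using assms by (auto simp: lesspoll_def lepoll_def)
  have "(UNIV :: 'u set) \<times> (UNIV :: 'u set) \<approx> (UNIV :: 'u set)"
    unfolding eqpoll_iff_card_of_ordIso by (rule card_of_Times_same_infinite[OF infinite_universe])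
  then obtain p :: "'u \<times> 'u \<Rightarrow> 'u" where p: "inj p"
    unfolding eqpoll_def UNIV_Times_UNIV by (elim exE) (rule that, erule bij_betw_imp_inj_on)
  have fg: "f ` A \<prec> (UNIV :: 'u set)" "g ` B \<prec> (UNIV :: 'u set)"
    by (rule lesspoll_image_iff[THEN iffD2, OF f assms(1)],
        rule lesspoll_image_iff[THEN iffD2, OF g assms(2)])
  have "(\<Union>i\<in>f ` A. p ` Pair i ` g ` B) \<prec> (UNIV :: 'u set)"
  proof (rule universe_Union[OF fg(1), of "\<lambda>i. p ` Pair i ` g ` B"])
    fix i
    have "inj_on (p \<circ> Pair i) (g ` B)"
      by (auto intro!: inj_onI dest!: injD[OF p])
    from lesspoll_image_iff[THEN iffD2, OF this fg(2)]
    show "p ` Pair i ` g ` B \<prec> (UNIV :: 'u set)"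
      by (simp only: image_comp comp_assoc)
  qed
  also have "(\<Union>i\<in>f ` A. p ` Pair i ` g ` B) = (\<lambda>(a, b). p (f a, g b)) ` (A \<times> B)"
    by force
  finally show ?thesis
    by (rule lesspoll_image_iff[THEN iffD1, rotated])
      (auto intro!: inj_onI dest!: injD[OF p] dest: inj_onD[OF f] inj_onD[OF g])
qed

lemma small_subset:
  fixes A :: "'b set"
  shows "B \<prec> (UNIV :: 'u set) \<Longrightarrow> A \<subseteq> B \<Longrightarrow> A \<prec> (UNIV :: 'u set)"
  by (meson lesspoll_trans1 subset_imp_lepoll)


section \<open>Clusters\<close>

text \<open>A cluster is stored as one flat set of atoms, so that the order is inclusion and meets
  are intersections. \<open>Bound B x y v\<close> says that \<open>v\<close> lies below the value at
  \<open>(x, y)\<close> of the structure on \<open>B\<close>.\<close>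

datatype ('u, 'v) atom =
  Mark 'u
| Glue "'u set" 'u 'u
| Bound "'u set" 'u 'u 'v

fun atom_on :: "'u set \<Rightarrow> ('u, 'v) atom \<Rightarrow> bool" where
  "atom_on X (Mark x) = (x \<in> X)"
| "atom_on X (Glue B x y) = (B \<subseteq> X \<and> x \<in> B \<and> y \<in> B)"
| "atom_on X (Bound B x y v) = (B \<subseteq> X \<and> x \<in> B \<and> y \<in> B)"

fun atom_map :: "('u \<Rightarrow> 'w) \<Rightarrow> ('u, 'v) atom \<Rightarrow> ('w, 'v) atom" where
  "atom_map f (Mark x) = Mark (f x)"
| "atom_map f (Glue B x y) = Glue (f ` B) (f x) (f y)"
| "atom_map f (Bound B x y v) = Bound (f ` B) (f x) (f y) v"

text \<open>By \<open>bound_down\<close> and \<open>bound_Sup\<close> the bounds over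
  \<open>B\<close> at \<open>(x, y)\<close> form a principal down-set, that is, they encode one
  value of the quantale. By \<open>glue_bound\<close> and \<open>bound_trans\<close> this value is
  invariant under gluing.\<close>

locale cluster =
  fixes tensor :: "'v :: complete_lattice \<Rightarrow> 'v \<Rightarrow> 'v"  (infixl \<open>\<otimes>\<close> 70)
    and k :: 'v and symm :: bool and A :: "('u :: universe, 'v) vcat" and T :: "('u, 'v) atom set"
  assumes on: "\<alpha> \<in> T \<Longrightarrow> atom_on (pts A) \<alpha>"
    and glue_refl: "\<lbrakk>B \<subseteq> pts A; x \<in> B\<rbrakk> \<Longrightarrow> Glue B x x \<in> T"
    and glue_sym: "Glue B x y \<in> T \<Longrightarrow> Glue B y x \<in> T"
    and glue_trans: "\<lbrakk>Glue B x y \<in> T; Glue B y z \<in> T\<rbrakk> \<Longrightarrow> Glue B x z \<in> T"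
    and glue_bound: "Glue B x y \<in> T \<Longrightarrow> Bound B x y k \<in> T"
    and bound_vhom: "\<lbrakk>B \<subseteq> pts A; x \<in> B; y \<in> B\<rbrakk> \<Longrightarrow> Bound B x y (vhom A (x, y)) \<in> T"
    and bound_down: "\<lbrakk>Bound B x y v \<in> T; w \<le> v\<rbrakk> \<Longrightarrow> Bound B x y w \<in> T"
    and bound_Sup:
      "\<lbrakk>B \<subseteq> pts A; x \<in> B; y \<in> B; \<And>v. v \<in> W \<Longrightarrow> Bound B x y v \<in> T\<rbrakk> \<Longrightarrow> Bound B x y (Sup W) \<in> T"
    and bound_trans: "\<lbrakk>Bound B x y v \<in> T; Bound B y z w \<in> T\<rbrakk> \<Longrightarrow> Bound B x z (v \<otimes> w) \<in> T"
    and bound_sym: "\<lbrakk>symm; Bound B x y v \<in> T\<rbrakk> \<Longrightarrow> Bound B y x v \<in> T"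
    and glue_restrict: "\<lbrakk>Glue B x y \<in> T; C \<subseteq> B; x \<in> C; y \<in> C\<rbrakk> \<Longrightarrow> Glue C x y \<in> T"
    and bound_restrict: "\<lbrakk>Bound B x y v \<in> T; C \<subseteq> B; x \<in> C; y \<in> C\<rbrakk> \<Longrightarrow> Bound C x y v \<in> T"
    and glue_extend:
      "\<lbrakk>Glue C x y \<in> T; C \<subseteq> B; B \<subseteq> pts A; \<And>b. b \<in> B \<Longrightarrow> \<exists>c\<in>C. Glue B b c \<in> T\<rbrakk> \<Longrightarrow> Glue B x y \<in> T"
    and bound_extend:
      "\<lbrakk>Bound C x y v \<in> T; C \<subseteq> B; B \<subseteq> pts A; \<And>b. b \<in> B \<Longrightarrow> \<exists>c\<in>C. Glue B b c \<in> T\<rbrakk>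
        \<Longrightarrow> Bound B x y v \<in> T"
    and mark_glue: "\<lbrakk>Mark x \<in> T; Glue B x y \<in> T\<rbrakk> \<Longrightarrow> Mark y \<in> T"
begin

text \<open>Glued points bound each other by the unit \<open>k\<close>, and composing with
  \<open>k\<close> on both sides leaves \<open>v\<close> unchanged.\<close>

lemma bound_glue_cong:
  assumes "comm_monoid tensor k"
    and "Glue B x x' \<in> T" "Glue B y y' \<in> T" "Bound B x y v \<in> T"
  shows "Bound B x' y' v \<in> T"
proof -
  interpret comm_monoid tensor k by fact
  have "Bound B x' y' (k \<otimes> v \<otimes> k) \<in> T"
    by (rule bound_trans[OF bound_trans[OF glue_bound[OF glue_sym[OF assms(2)]] assms(4)]
          glue_bound[OF assms(3)]])
  then show ?thesis by simp
qed

end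

text \<open>One formula for three clusters: \<open>S = {}\<close> gives the least one, since the
  empty set has no points to relate, \<open>S = pts A\<close> the greatest, and the range of a
  morphism its image.\<close>

definition atoms_over :: "('u, 'v) vcat \<Rightarrow> 'u set \<Rightarrow> ('u, 'v :: order) atom set" where
  "atoms_over A S = {\<alpha>. atom_on (pts A) \<alpha> \<and>
     (case \<alpha> of
        Mark x \<Rightarrow> x \<in> S
      | Glue B x y \<Rightarrow> B \<subseteq> S \<or> x = y
      | Bound B x y v \<Rightarrow> B \<subseteq> S \<or> v \<le> vhom A (x, y))}"

lemma mem_atoms_over [simp]:
  "Mark x \<in> atoms_over A S \<longleftrightarrow> x \<in> pts A \<and> x \<in> S"
  "Glue B x y \<in> atoms_over A S \<longleftrightarrow> B \<subseteq> pts A \<and> x \<in> B \<and> y \<in> B \<and> (B \<subseteq> S \<or> x = y)"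
  "Bound B x y v \<in> atoms_over A S \<longleftrightarrow>
     B \<subseteq> pts A \<and> x \<in> B \<and> y \<in> B \<and> (B \<subseteq> S \<or> v \<le> vhom A (x, y))"
  by (auto simp: atoms_over_def)

lemma atoms_over_pts: "atoms_over A (pts A) = {\<alpha>. atom_on (pts A) \<alpha>}"
proof -
  have "\<alpha> \<in> atoms_over A (pts A) \<longleftrightarrow> atom_on (pts A) \<alpha>" for \<alpha>
    by (cases \<alpha>) auto
  then show ?thesis by auto
qed

text \<open>The flag \<open>symm\<close> decides whether objects and clusters have to be symmetric,
  so that one development covers both categories.\<close>

locale vcat_form = commutative_unital_quantale tensor k
  for tensor :: "'v :: complete_lattice \<Rightarrow> 'v \<Rightarrow> 'v"  (infixl \<open>\<otimes>\<close> 70) and k :: 'v +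
  fixes symm :: bool
begin

section \<open>Objects and morphisms\<close>

lemma tensor_mono:
  assumes "x \<le> x'" "y \<le> y'"
  shows "x \<otimes> y \<le> x' \<otimes> y'"
proof -
  have "x \<otimes> y \<le> x' \<otimes> y"
    using Sup_tensor[of "{x, x'}" y] assms(1) by (simp add: sup.absorb2 sup.absorb_iff2 le_iff_sup)
  also have "\<dots> \<le> x' \<otimes> y'"
    using tensor_Sup[of x' "{y, y'}"] assms(2) by (simp add: le_iff_sup)
  finally show ?thesis .
qed

definition obj :: "('u :: universe, 'v) vcat \<Rightarrow> bool" where
  "obj A \<longleftrightarrow> is_vcat tensor k A \<and> (symm \<longrightarrow> symmetric_vcat A)"

definition mor :: "('u :: universe, 'v) vfunctor \<Rightarrow> bool" where
  "mor f \<longleftrightarrow> is_vfunctor tensor k f \<and> obj (src f) \<and> obj (tgt f)"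

abbreviation clus :: "('u :: universe, 'v) vcat \<Rightarrow> ('u, 'v) atom set \<Rightarrow> bool" where
  "clus \<equiv> cluster tensor k symm"

lemma objD:
  fixes A :: "('u :: universe, 'v) vcat"
  assumes "obj A"
  shows "x \<in> pts A \<Longrightarrow> k \<le> vhom A (x, x)"
    and "\<lbrakk>x \<in> pts A; y \<in> pts A; z \<in> pts A\<rbrakk> \<Longrightarrow> vhom A (x, y) \<otimes> vhom A (y, z) \<le> vhom A (x, z)"
    and "\<lbrakk>symm; x \<in> pts A; y \<in> pts A\<rbrakk> \<Longrightarrow> vhom A (x, y) = vhom A (y, x)"
    and "vhom A \<in> extensional (pts A \<times> pts A)"
    and "pts A \<prec> (UNIV :: 'u set)"
  using assms unfolding obj_def is_vcat_def symmetric_vcat_def PiE_def by auto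

lemma morD:
  assumes "mor f"
  shows "obj (src f)" "obj (tgt f)"
    and "x \<in> pts (src f) \<Longrightarrow> fn f x \<in> pts (tgt f)"
    and "fn f \<in> extensional (pts (src f))"
    and "\<lbrakk>x \<in> pts (src f); y \<in> pts (src f)\<rbrakk> \<Longrightarrow> vhom (src f) (x, y) \<le> vhom (tgt f) (fn f x, fn f y)"
  using assms unfolding mor_def is_vfunctor_def PiE_def by auto

section \<open>Full clusters, intersections and generated clusters\<close>

lemma cluster_atoms_over:
  assumes "obj A"
  shows "clus A (atoms_over A S)"
proof
  show "Bound B x z (v \<otimes> w) \<in> atoms_over A S"
    if "Bound B x y v \<in> atoms_over A S" "Bound B y z w \<in> atoms_over A S" for B x y z v w
  proof (cases "B \<subseteq> S")
    case False
    then have "v \<otimes> w \<le> vhom A (x, y) \<otimes> vhom A (y, z)"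
      using that by (intro tensor_mono) auto
    also have "\<dots> \<le> vhom A (x, z)"
      using that by (intro objD(2)[OF assms]) auto
    finally show ?thesis
      using that by simp
  qed (use that in auto)
  show "Bound B x y (Sup W) \<in> atoms_over A S"
    if "B \<subseteq> pts A" "x \<in> B" "y \<in> B" "\<And>v. v \<in> W \<Longrightarrow> Bound B x y v \<in> atoms_over A S" for B x y W
    using that by (cases "B \<subseteq> S") (auto intro!: Sup_least)
  show "Bound B x y k \<in> atoms_over A S" if "Glue B x y \<in> atoms_over A S" for B x y
    using that objD(1)[OF assms, of x] by auto
  show "Bound B y x v \<in> atoms_over A S" if symm "Bound B x y v \<in> atoms_over A S" for B x y v
    using that objD(3)[OF assms \<open>symm\<close>, of x y] by (cases "B \<subseteq> S") (simp_all add: subset_iff)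
  fix B C x y v
  assume B: "C \<subseteq> B" "B \<subseteq> pts A" and ex: "\<And>b. b \<in> B \<Longrightarrow> \<exists>c\<in>C. Glue B b c \<in> atoms_over A S"
  \<comment> \<open>Over a set \<open>B\<close> outside \<open>S\<close> only equal points are
    glued, so a \<open>C\<close> to which every point of \<open>B\<close> is glued must be all of
    \<open>B\<close>, and extension is trivial.\<close>
  have "B \<subseteq> S \<or> B = C"
    using B ex by auto
  then show "Glue C x y \<in> atoms_over A S \<Longrightarrow> Glue B x y \<in> atoms_over A S"
    and "Bound C x y v \<in> atoms_over A S \<Longrightarrow> Bound B x y v \<in> atoms_over A S"
    using B by auto
next
  show "Bound B x y w \<in> atoms_over A S" if "Bound B x y v \<in> atoms_over A S" "w \<le> v" for B x y v w
    using that by (auto intro: order_trans[of w v])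
qed (auto simp: atoms_over_def)

text \<open>The existential premise of the extension axioms passes from the intersection to each
  member, with the same witness, so these axioms survive intersections like the others. Nonemptiness
  keeps the atoms on \<open>pts A\<close>.\<close>

lemma cluster_Inter:
  assumes ne: "\<T> \<noteq> {}" and c: "\<And>T. T \<in> \<T> \<Longrightarrow> clus A T"
  shows "clus A (\<Inter>\<T>)"
proof
  show "atom_on (pts A) \<alpha>" if "\<alpha> \<in> \<Inter>\<T>" for \<alpha>
    using that ne c[THEN cluster.on] by fastforce
  show "Bound B x y (Sup W) \<in> \<Inter>\<T>"
    if "B \<subseteq> pts A" "x \<in> B" "y \<in> B" "\<And>v. v \<in> W \<Longrightarrow> Bound B x y v \<in> \<Inter>\<T>" for B x y W
    using that by (intro InterI cluster.bound_Sup[OF c]) auto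
  fix B C x y v
  assume B: "C \<subseteq> B" "B \<subseteq> pts A" and ex: "\<And>b. b \<in> B \<Longrightarrow> \<exists>c\<in>C. Glue B b c \<in> \<Inter>\<T>"
  have ex': "\<exists>c\<in>C. Glue B b c \<in> T" if "T \<in> \<T>" "b \<in> B" for b T
    using ex[OF that(2)] that(1) by blast
  show "Glue B x y \<in> \<Inter>\<T>" if "Glue C x y \<in> \<Inter>\<T>"
    using that by (intro InterI cluster.glue_extend[OF c _ B ex']) auto
  show "Bound B x y v \<in> \<Inter>\<T>" if "Bound C x y v \<in> \<Inter>\<T>"
    using that by (intro InterI cluster.bound_extend[OF c _ B ex']) auto
qed (simp_all add: c[THEN cluster.glue_refl] c[THEN cluster.glue_bound] c[THEN cluster.bound_vhom]
    c[THEN cluster.glue_sym] c[THEN cluster.bound_sym],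
  (meson c cluster.glue_trans cluster.bound_down cluster.bound_trans cluster.glue_restrict
    cluster.bound_restrict cluster.mark_glue)+)

lemma cluster_bot_subset:
  assumes "clus A T"
  shows "atoms_over A {} \<subseteq> T"
proof
  interpret cluster tensor k symm A T by fact
  fix \<alpha> assume "\<alpha> \<in> atoms_over A {}"
  then show "\<alpha> \<in> T"
    by (cases \<alpha>) (auto intro: glue_refl bound_vhom bound_down)
qed

lemma cluster_subset_top: "clus A T \<Longrightarrow> T \<subseteq> atoms_over A (pts A)"
  using cluster.on by (auto simp: atoms_over_pts)

text \<open>Joins and direct images are not set-theoretic, so they are taken as generated clusters.
  For atoms \<open>R\<close> on an object the family is nonempty, because it contains the greatest
  cluster.\<close>

definition gen :: "('u :: universe, 'v) vcat \<Rightarrow> ('u, 'v) atom set \<Rightarrow> ('u, 'v) atom set" where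
  "gen A R = \<Inter>{T. clus A T \<and> R \<subseteq> T}"

lemma cluster_gen:
  assumes "obj A" "R \<subseteq> atoms_over A (pts A)"
  shows "clus A (gen A R)"
  unfolding gen_def using assms cluster_atoms_over by (intro cluster_Inter) auto

lemma gen_subset_iff: "clus A T \<Longrightarrow> gen A R \<subseteq> T \<longleftrightarrow> R \<subseteq> T"
  unfolding gen_def by blast

lemma cluster_Int: "clus A S \<Longrightarrow> clus A T \<Longrightarrow> clus A (S \<inter> T)"
  using cluster_Inter[of "{S, T}" A] by auto

section \<open>Inverse and direct images of clusters\<close>

definition pullc :: "('u :: universe, 'v) vfunctor \<Rightarrow> ('u, 'v) atom set \<Rightarrow> ('u, 'v) atom set" where
  "pullc f U = {\<alpha>. atom_on (pts (src f)) \<alpha> \<and> atom_map (fn f) \<alpha> \<in> U}"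

definition pushc :: "('u :: universe, 'v) vfunctor \<Rightarrow> ('u, 'v) atom set \<Rightarrow> ('u, 'v) atom set" where
  "pushc f T = gen (tgt f) (atom_map (fn f) ` T)"

lemma atom_map_on:
  assumes "mor f" "atom_on (pts (src f)) \<alpha>"
  shows "atom_map (fn f) \<alpha> \<in> atoms_over (tgt f) (pts (tgt f))"
  using assms(2) morD(3)[OF assms(1)] by (cases \<alpha>) auto

lemma mem_pullc [simp]:
  "Mark x \<in> pullc f U \<longleftrightarrow> x \<in> pts (src f) \<and> Mark (fn f x) \<in> U"
  "Glue B x y \<in> pullc f U \<longleftrightarrow> B \<subseteq> pts (src f) \<and> x \<in> B \<and> y \<in> B \<and> Glue (fn f ` B) (fn f x) (fn f y) \<in> U"
  "Bound B x y v \<in> pullc f U \<longleftrightarrow>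
     B \<subseteq> pts (src f) \<and> x \<in> B \<and> y \<in> B \<and> Bound (fn f ` B) (fn f x) (fn f y) v \<in> U"
  by (auto simp: pullc_def)

lemma cluster_pushc:
  assumes "mor f" "clus (src f) T"
  shows "clus (tgt f) (pushc f T)"
  unfolding pushc_def
  using assms by (intro cluster_gen morD(2)) (auto intro!: atom_map_on dest: cluster.on)

text \<open>Direct images of sets preserve inclusions and carry premises about the points of
  \<open>B\<close> to its image, so the axioms for the pullback are instances of those for
  \<open>U\<close>; \<open>bound_vhom\<close> also uses the inequality that defines a
  morphism.\<close>

lemma cluster_pullc:
  assumes f: "mor f" and U: "clus (tgt f) U"
  shows "clus (src f) (pullc f U)"
proof -
  interpret U: cluster tensor k symm "tgt f" U by fact
  have sub: "fn f ` B \<subseteq> pts (tgt f)" if "B \<subseteq> pts (src f)" for B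
    using that morD(3)[OF f] by auto
  show ?thesis
  proof
    show "Bound B x y (vhom (src f) (x, y)) \<in> pullc f U"
      if B: "B \<subseteq> pts (src f)" "x \<in> B" "y \<in> B" for B x y
    proof -
      have "Bound (fn f ` B) (fn f x) (fn f y) (vhom (src f) (x, y)) \<in> U"
        using B by (intro U.bound_down[OF U.bound_vhom[OF sub]] morD(5)[OF f]) auto
      then show ?thesis
        using B by simp
    qed
    fix B C x y v
    assume B: "C \<subseteq> B" "B \<subseteq> pts (src f)" and ex: "\<And>b. b \<in> B \<Longrightarrow> \<exists>c\<in>C. Glue B b c \<in> pullc f U"
    have ex': "\<exists>c\<in>fn f ` C. Glue (fn f ` B) b c \<in> U" if "b \<in> fn f ` B" for b
      using that ex by fastforce
    show "Glue C x y \<in> pullc f U \<Longrightarrow> Glue B x y \<in> pullc f U"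
      using B U.glue_extend[of "fn f ` C" _ _ "fn f ` B", OF _ image_mono sub ex'] by auto
    show "Bound C x y v \<in> pullc f U \<Longrightarrow> Bound B x y v \<in> pullc f U"
      using B U.bound_extend[of "fn f ` C" _ _ _ "fn f ` B", OF _ image_mono sub ex'] by auto
  next
    show "Glue B x x \<in> pullc f U" if "B \<subseteq> pts (src f)" "x \<in> B" for B x
      using that U.glue_refl[OF sub] by simp
    show "Bound B x y (Sup W) \<in> pullc f U"
      if "B \<subseteq> pts (src f)" "x \<in> B" "y \<in> B" "\<And>v. v \<in> W \<Longrightarrow> Bound B x y v \<in> pullc f U" for B x y W
      using that U.bound_Sup[OF sub] by simp
  next
    show "Glue C x y \<in> pullc f U" if "Glue B x y \<in> pullc f U" "C \<subseteq> B" "x \<in> C" "y \<in> C" for B C x y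
      using that U.glue_restrict[of "fn f ` B" _ _ "fn f ` C", OF _ image_mono] by auto
    show "Bound C x y v \<in> pullc f U"
      if "Bound B x y v \<in> pullc f U" "C \<subseteq> B" "x \<in> C" "y \<in> C" for B C x y v
      using that U.bound_restrict[of "fn f ` B" _ _ _ "fn f ` C", OF _ image_mono] by auto
  qed (auto simp: pullc_def intro: U.glue_sym U.glue_bound U.bound_down U.bound_sym
      dest: U.glue_trans U.bound_trans U.mark_glue)
qed

text \<open>Both sides say that \<open>atom_map (fn f)\<close> sends \<open>T\<close> into
  \<open>U\<close>, because \<open>pushc f T\<close> is generated by the image of \<open>T\<close>
  and \<open>U\<close> is a cluster.\<close>

lemma pushc_subset_iff:
  assumes "clus (src f) T" "clus (tgt f) U"
  shows "pushc f T \<subseteq> U \<longleftrightarrow> T \<subseteq> pullc f U"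
  unfolding pushc_def gen_subset_iff[OF assms(2)]
  using cluster.on[OF assms(1)] by (auto simp: pullc_def)


section \<open>Images and kernels\<close>

abbreviation top_cluster :: "('u :: universe, 'v) vcat \<Rightarrow> ('u, 'v) atom set" where
  "top_cluster A \<equiv> atoms_over A (pts A)"

abbreviation bot_cluster :: "('u :: universe, 'v) vcat \<Rightarrow> ('u, 'v) atom set" where
  "bot_cluster A \<equiv> atoms_over A {}"

definition kerc :: "('u :: universe, 'v) vfunctor \<Rightarrow> ('u, 'v) atom set" where
  "kerc f = pullc f (bot_cluster (tgt f))"

definition vrange :: "('u :: universe, 'v) vfunctor \<Rightarrow> 'u set" where
  "vrange f = fn f ` pts (src f)"

definition imgc :: "('u :: universe, 'v) vfunctor \<Rightarrow> ('u, 'v) atom set" where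
  "imgc f = atoms_over (tgt f) (vrange f)"

lemma vrange_subset: "mor f \<Longrightarrow> vrange f \<subseteq> pts (tgt f)"
  using morD(3) by (auto simp: vrange_def)

text \<open>The least cluster has no marks, glues only equal points and keeps the given structure
  over every set. Hence \<open>B\<close> enters only as a set that contains \<open>x\<close> and
  \<open>y\<close>.\<close>

lemma mem_kerc:
  assumes "mor f"
  shows "Mark x \<notin> kerc f"
    and "Glue B x y \<in> kerc f \<longleftrightarrow> B \<subseteq> pts (src f) \<and> x \<in> B \<and> y \<in> B \<and> fn f x = fn f y"
    and "Bound B x y v \<in> kerc f \<longleftrightarrow>
      B \<subseteq> pts (src f) \<and> x \<in> B \<and> y \<in> B \<and> v \<le> vhom (tgt f) (fn f x, fn f y)"
  using vrange_subset[OF assms] by (auto simp: kerc_def vrange_def)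

lemma cluster_kerc: "mor f \<Longrightarrow> clus (src f) (kerc f)"
  unfolding kerc_def by (intro cluster_pullc cluster_atoms_over morD(2))

lemma cluster_imgc: "mor f \<Longrightarrow> clus (tgt f) (imgc f)"
  unfolding imgc_def by (intro cluster_atoms_over morD(2))

lemma pushc_subset_top: "mor f \<Longrightarrow> clus (src f) T \<Longrightarrow> pushc f T \<subseteq> imgc f"
  unfolding pushc_def imgc_def
proof (subst gen_subset_iff)
  assume f: "mor f" and T: "clus (src f) T"
  show "clus (tgt f) (atoms_over (tgt f) (vrange f))"
    using f by (intro cluster_atoms_over morD(2))
  have "atom_map (fn f) \<alpha> \<in> atoms_over (tgt f) (vrange f)" if "\<alpha> \<in> T" for \<alpha>
    using cluster.on[OF T that] vrange_subset[OF f] by (cases \<alpha>) (auto simp: vrange_def)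
  then show "atom_map (fn f) ` T \<subseteq> atoms_over (tgt f) (vrange f)"
    by blast
qed

lemma mem_pushcI: "\<alpha> \<in> T \<Longrightarrow> atom_map (fn f) \<alpha> \<in> pushc f T"
  by (auto simp: pushc_def gen_def)

text \<open>An atom over a set \<open>B\<close> in the range of \<open>f\<close> is pushed forward from the full preimage of \<open>B\<close>.\<close>

lemma pushc_pullc:
  assumes f: "mor f" and T: "clus (tgt f) T"
  shows "pushc f (pullc f T) = T \<inter> imgc f"
proof
  have P: "clus (src f) (pullc f T)"
    using assms by (rule cluster_pullc)
  show "pushc f (pullc f T) \<subseteq> T \<inter> imgc f"
    using pushc_subset_iff[OF P T] pushc_subset_top[OF f P] by blast
  have bot: "bot_cluster (tgt f) \<subseteq> pushc f (pullc f T)"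
    by (rule cluster_bot_subset[OF cluster_pushc[OF f P]])
  show "T \<inter> imgc f \<subseteq> pushc f (pullc f T)"
  proof
    fix \<beta> assume \<beta>: "\<beta> \<in> T \<inter> imgc f"
    show "\<beta> \<in> pushc f (pullc f T)"
    \<comment> \<open>Atoms of the least cluster lie in every cluster. Any other atom of
      \<open>imgc f\<close> is a mark in the range or lives over a subset of the range, so it comes
      from an atom on the source.\<close>
    proof (cases "\<beta> \<in> bot_cluster (tgt f)")
      case False
      define P where "P B = pts (src f) \<inter> fn f -` B" for B
      have P: "fn f ` P B = B" if "B \<subseteq> vrange f" for B
        using that by (auto simp: P_def vrange_def)
      have "\<exists>\<alpha>. atom_on (pts (src f)) \<alpha> \<and> \<beta> = atom_map (fn f) \<alpha>"
      proof (cases \<beta>)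
        case (Mark y)
        then obtain x where "x \<in> pts (src f)" "y = fn f x"
          using \<beta> by (auto simp: imgc_def vrange_def)
        then show ?thesis
          using Mark by (intro exI[of _ "Mark x"]) auto
      next
        case (Glue B y z)
        then have B: "B \<subseteq> vrange f" "y \<in> B" "z \<in> B"
          using \<beta> False by (auto simp: imgc_def)
        then obtain x w where "x \<in> P B" "w \<in> P B" "y = fn f x" "z = fn f w"
          using P[OF B(1)] by blast
        then show ?thesis
          using Glue P[OF B(1)] by (intro exI[of _ "Glue (P B) x w"]) (auto simp: P_def)
      next
        case (Bound B y z v)
        then have B: "B \<subseteq> vrange f" "y \<in> B" "z \<in> B"
          using \<beta> False by (auto simp: imgc_def)
        then obtain x w where "x \<in> P B" "w \<in> P B" "y = fn f x" "z = fn f w"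
          using P[OF B(1)] by blast
        then show ?thesis
          using Bound P[OF B(1)] by (intro exI[of _ "Bound (P B) x w v"]) (auto simp: P_def)
      qed
      then show ?thesis
        using \<beta> mem_pushcI[of _ "pullc f T" f] by (auto simp: pullc_def)
    qed (use bot in blast)
  qed
qed

text \<open>The greatest cluster pulls back to the greatest cluster, so this is an instance of
  \<open>pushc_pullc\<close>.\<close>

lemma pushc_top:
  assumes "mor f"
  shows "pushc f (top_cluster (src f)) = imgc f"
proof -
  have "pullc f (top_cluster (tgt f)) = top_cluster (src f)"
    using atom_map_on[OF assms] by (auto simp: pullc_def atoms_over_pts)
  then show ?thesis
    using pushc_pullc[OF assms cluster_atoms_over[OF morD(2)[OF assms]], of "pts (tgt f)"]
      cluster_subset_top[OF cluster_imgc[OF assms]] by auto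
qed

text \<open>The structure of \<open>W\<close> over full preimages is transported along a section of \<open>f\<close>.\<close>

lemma ex_saturated_cluster:
  assumes f: "mor f" and W: "clus (src f) W" and ker: "kerc f \<subseteq> W"
  shows "\<exists>U. clus (tgt f) U \<and> atom_map (fn f) ` W \<subseteq> U \<and> pullc f U \<subseteq> W"
proof -
  interpret W: cluster tensor k symm "src f" W by fact
  define X where "X = pts (src f)"
  define P where "P B = X \<inter> fn f -` B" for B
  \<comment> \<open>\<open>g\<close> chooses one point in each fibre of \<open>f\<close> over its
    range.\<close>
  define g where "g = inv_into X (fn f)"
  have g: "g y \<in> X" "fn f (g y) = y" if "y \<in> vrange f" for y
    using that by (auto simp: g_def X_def vrange_def inv_into_into f_inv_into_f)
  have gP: "g y \<in> P B" if "y \<in> B" "B \<subseteq> vrange f" for y B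
    using that g[of y] by (auto simp: P_def)
  have PX: "P B \<subseteq> X" for B by (auto simp: P_def)
  have PXs: "P B \<subseteq> pts (src f)" for B by (auto simp: P_def X_def)
  have N: "Glue B x y \<in> W" if "B \<subseteq> X" "x \<in> B" "y \<in> B" "fn f x = fn f y" for B x y
    using that ker mem_kerc(2)[OF f] by (auto simp: X_def)
  have N': "Glue B x (g (fn f x)) \<in> W" if "B \<subseteq> X" "x \<in> B" "g (fn f x) \<in> B" for B x
    using that by (intro N g(2)[symmetric]) (auto simp: X_def vrange_def)
  have V: "Bound B x y v \<in> W" if "B \<subseteq> X" "x \<in> B" "y \<in> B" "v \<le> vhom (tgt f) (fn f x, fn f y)" for B x y v
    using that ker mem_kerc(3)[OF f] by (auto simp: X_def)
  have rgX: "fn f ` B \<subseteq> vrange f" if "B \<subseteq> X" for B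
    using that by (auto simp: vrange_def X_def)
  have sub: "B \<subseteq> P (fn f ` B)" if "B \<subseteq> X" for B
    using that by (auto simp: P_def)
  \<comment> \<open>\<open>P\<close> of the image of \<open>B\<close> is the saturation of
    \<open>B\<close>. Over it the kernel, which lies in \<open>W\<close>, glues each point of
    \<open>B\<close> to the chosen point of its fibre.\<close>
  have NP: "Glue (P (fn f ` B)) x (g (fn f x)) \<in> W" if "B \<subseteq> X" "x \<in> B" for B x
    using that sub[OF that(1)] by (intro N' PX gP rgX) auto
  \<comment> \<open>Over a set inside the range, \<open>U\<close> repeats what \<open>W\<close> has
    over the full preimage, read at the chosen points; over any other set it is trivial.\<close>
  define U where "U = {\<beta>. case \<beta> of
      Mark y \<Rightarrow> y \<in> vrange f \<and> Mark (g y) \<in> W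
    | Glue B y z \<Rightarrow> y \<in> B \<and> z \<in> B \<and>
        (if B \<subseteq> vrange f then Glue (P B) (g y) (g z) \<in> W else B \<subseteq> pts (tgt f) \<and> y = z)
    | Bound B y z v \<Rightarrow> y \<in> B \<and> z \<in> B \<and>
        (if B \<subseteq> vrange f then Bound (P B) (g y) (g z) v \<in> W
         else B \<subseteq> pts (tgt f) \<and> v \<le> vhom (tgt f) (y, z))}"
  have [simp]: "Mark y \<in> U \<longleftrightarrow> y \<in> vrange f \<and> Mark (g y) \<in> W"
    "Glue B y z \<in> U \<longleftrightarrow> y \<in> B \<and> z \<in> B \<and>
        (if B \<subseteq> vrange f then Glue (P B) (g y) (g z) \<in> W else B \<subseteq> pts (tgt f) \<and> y = z)"
    "Bound B y z v \<in> U \<longleftrightarrow> y \<in> B \<and> z \<in> B \<and>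
        (if B \<subseteq> vrange f then Bound (P B) (g y) (g z) v \<in> W
         else B \<subseteq> pts (tgt f) \<and> v \<le> vhom (tgt f) (y, z))" for y z B v
    by (simp_all add: U_def)
  have bot: "clus (tgt f) (bot_cluster (tgt f))"
    by (rule cluster_atoms_over[OF morD(2)[OF f]])
  have rg: "B \<subseteq> pts (tgt f)" if "B \<subseteq> vrange f" for B
    using that vrange_subset[OF f] by blast
  have Pmono: "P C \<subseteq> P B" if "C \<subseteq> B" for B C
    using that by (auto simp: P_def)
  have "clus (tgt f) U"
  proof
    show "atom_on (pts (tgt f)) \<beta>" if "\<beta> \<in> U" for \<beta>
      using that rg by (cases \<beta>) (auto split: if_splits)
    show "Glue B x x \<in> U" if "B \<subseteq> pts (tgt f)" "x \<in> B" for B x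
      using that by (auto intro!: W.glue_refl[OF PXs gP])
    show "Glue B y x \<in> U" if "Glue B x y \<in> U" for B x y
      using that W.glue_sym[of "P B" "g x" "g y"] by (auto split: if_splits)
    show "Glue B x z \<in> U" if "Glue B x y \<in> U" "Glue B y z \<in> U" for B x y z
      using that W.glue_trans[of "P B" "g x" "g y" "g z"] by (auto split: if_splits)
    show "Bound B x y k \<in> U" if "Glue B x y \<in> U" for B x y
      using that objD(1)[OF morD(2)[OF f], of x] by (auto intro: W.glue_bound split: if_splits)
    show "Bound B x y (vhom (tgt f) (x, y)) \<in> U" if "B \<subseteq> pts (tgt f)" "x \<in> B" "y \<in> B" for B x y
    proof (cases "B \<subseteq> vrange f")
      case True
      then have "x \<in> vrange f" "y \<in> vrange f"
        using that by auto
      then show ?thesis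
        using that True by (auto intro!: V gP PX simp: g)
    qed (use that in simp)
    show "Bound B x y w \<in> U" if "Bound B x y v \<in> U" "w \<le> v" for B x y v w
      using that W.bound_down[of "P B" "g x" "g y" v w] by (auto split: if_splits)
    show "Bound B x y (Sup Z) \<in> U"
      if "B \<subseteq> pts (tgt f)" "x \<in> B" "y \<in> B" "\<And>v. v \<in> Z \<Longrightarrow> Bound B x y v \<in> U" for B x y Z
    proof (cases "B \<subseteq> vrange f")
      case True
      then show ?thesis
        using that by (auto intro!: W.bound_Sup[OF PXs gP gP])
    qed (use that in \<open>auto intro!: Sup_least\<close>)
    show "Bound B x z (v \<otimes> w) \<in> U" if "Bound B x y v \<in> U" "Bound B y z w \<in> U" for B x y z v w
    proof (cases "B \<subseteq> vrange f")
      case True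
      then show ?thesis
        using that W.bound_trans[of "P B" "g x" "g y" v "g z" w] by auto
    next
      case False
      then have "Bound B x z (v \<otimes> w) \<in> bot_cluster (tgt f)"
        using that by (intro cluster.bound_trans[OF bot, of B x y v z w]) auto
      then show ?thesis
        using False by auto
    qed
    show "Bound B y x v \<in> U" if symm "Bound B x y v \<in> U" for B x y v
    proof (cases "B \<subseteq> vrange f")
      case True
      then show ?thesis
        using that W.bound_sym[of "P B" "g x" "g y" v] by auto
    next
      case False
      then have "Bound B y x v \<in> bot_cluster (tgt f)"
        using that by (intro cluster.bound_sym[OF bot, of B x y v]) auto
      then show ?thesis
        using False by auto
    qed
    show "Glue C x y \<in> U" if "Glue B x y \<in> U" "C \<subseteq> B" "x \<in> C" "y \<in> C" for B C x y
    proof (cases "B \<subseteq> vrange f")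
      case True
      then have "C \<subseteq> vrange f" using that by blast
      then show ?thesis
        using that True W.glue_restrict[OF _ Pmono[OF that(2)], of "g x" "g y"]
        by (auto simp: gP)
    next
      case False
      then show ?thesis
        using that by (auto intro!: W.glue_refl[OF PXs gP])
    qed
    show "Bound C x y v \<in> U" if "Bound B x y v \<in> U" "C \<subseteq> B" "x \<in> C" "y \<in> C" for B C x y v
    proof (cases "B \<subseteq> vrange f")
      case True
      then have "C \<subseteq> vrange f" using that by blast
      then show ?thesis
        using that True W.bound_restrict[OF _ Pmono[OF that(2)], of "g x" "g y" v]
        by (auto simp: gP)
    next
      case False
      \<comment> \<open>A set \<open>B\<close> that leaves the range may have a subset
        \<open>C\<close> inside it. The trivial structure over \<open>C\<close> still belongs to
        \<open>U\<close>, because its pullback is part of the kernel and hence of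
        \<open>W\<close>.\<close>
      show ?thesis
      proof (cases "C \<subseteq> vrange f")
        case True
        then have "x \<in> vrange f" "y \<in> vrange f"
          using that by auto
        then show ?thesis
          using that True False by (auto intro!: V gP PX simp: g)
      qed (use that False in auto)
    qed
  next
    fix B C x y v
    assume B: "C \<subseteq> B" "B \<subseteq> pts (tgt f)" and ex: "\<And>b. b \<in> B \<Longrightarrow> \<exists>c\<in>C. Glue B b c \<in> U"
    \<comment> \<open>If \<open>B\<close> leaves the range, only equal points are glued over it.
      Otherwise a point of \<open>P B\<close> is glued to the chosen point of its fibre, and this in
      turn to the chosen point over some \<open>c\<close> in \<open>C\<close>, so that the extension
      axiom of \<open>W\<close> applies to \<open>P C\<close> and \<open>P B\<close>.\<close>
    have "C = B" if "\<not> B \<subseteq> vrange f"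
      using that ex B by auto
    moreover have ex': "\<exists>c\<in>P C. Glue (P B) b c \<in> W" if rg: "B \<subseteq> vrange f" and bP: "b \<in> P B" for b
    proof -
      have b: "fn f b \<in> B" "b \<in> X"
        using bP by (auto simp: P_def)
      then obtain c where c: "c \<in> C" "Glue (P B) (g (fn f b)) (g c) \<in> W"
        using ex[of "fn f b"] rg by auto
      have "Glue (P B) b (g (fn f b)) \<in> W"
        using rg bP b by (intro N' PX gP)
      then have "Glue (P B) b (g c) \<in> W"
        using c(2) by (rule W.glue_trans)
      moreover have "g c \<in> P C"
        using c(1) rg B by (intro gP) auto
      ultimately show ?thesis ..
    qed
    ultimately show "Glue B x y \<in> U" if "Glue C x y \<in> U"
      using that B PX Pmono[OF B(1)] W.glue_extend[of "P C" "g x" "g y" "P B"]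
      by (cases "B \<subseteq> vrange f") (auto simp: X_def)
    show "Bound B x y v \<in> U" if "Bound C x y v \<in> U"
      using that B PX Pmono[OF B(1)] W.bound_extend[of "P C" "g x" "g y" v "P B"] ex'
        \<open>\<not> B \<subseteq> vrange f \<Longrightarrow> C = B\<close>
      by (cases "B \<subseteq> vrange f") (auto simp: X_def)
  next
    show "Mark y \<in> U" if "Mark x \<in> U" "Glue B x y \<in> U" for B x y
      using that W.mark_glue[of "g x" "P B" "g y"] by (auto split: if_splits)
  qed
  moreover have "atom_map (fn f) ` W \<subseteq> U"
  proof safe
    fix \<alpha> assume \<alpha>: "\<alpha> \<in> W"
    \<comment> \<open>Each point of the saturation of \<open>B\<close> has the same value under
      \<open>f\<close> as some point of \<open>B\<close>, so the kernel glues them. The extension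
      axiom therefore lifts atoms of \<open>W\<close> from \<open>B\<close> to its saturation, from
      where gluing moves them to the chosen points.\<close>
    have ext: "\<exists>c\<in>B. Glue (P (fn f ` B)) b c \<in> W" if "b \<in> P (fn f ` B)" "B \<subseteq> X" for b B
      using that by (auto simp: P_def intro!: N)
    show "atom_map (fn f) \<alpha> \<in> U"
    proof (cases \<alpha>)
      case (Mark x)
      then have "x \<in> X"
        using \<alpha> W.on by (fastforce simp: X_def)
      then show ?thesis
        using Mark \<alpha> W.mark_glue[of x X "g (fn f x)"] N'[of X x] g[of "fn f x"]
        by (auto simp: vrange_def X_def)
    next
      case (Glue B x y)
      then have B: "B \<subseteq> X" "x \<in> B" "y \<in> B"
        using \<alpha> W.on by (fastforce simp: X_def)+
      let ?B = "P (fn f ` B)"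
      have "Glue ?B x y \<in> W"
        using Glue \<alpha> B PX by (intro W.glue_extend[OF _ sub _ ext]) (auto simp: X_def)
      moreover have "Glue ?B x (g (fn f x)) \<in> W" "Glue ?B y (g (fn f y)) \<in> W"
        using B by (auto intro: NP)
      ultimately show ?thesis
        using Glue B rgX[OF B(1)] W.glue_trans[OF W.glue_sym W.glue_trans, of ?B x "g (fn f x)" y "g (fn f y)"]
        by auto
    next
      case (Bound B x y v)
      then have B: "B \<subseteq> X" "x \<in> B" "y \<in> B"
        using \<alpha> W.on by (fastforce simp: X_def)+
      let ?B = "P (fn f ` B)"
      have "Bound ?B x y v \<in> W"
        using Bound \<alpha> B PX by (intro W.bound_extend[OF _ sub _ ext]) (auto simp: X_def)
      moreover have "Glue ?B x (g (fn f x)) \<in> W" "Glue ?B y (g (fn f y)) \<in> W"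
        using B by (auto intro: NP)
      ultimately show ?thesis
        using Bound B rgX[OF B(1)]
          W.bound_glue_cong[OF comm_monoid_axioms, of ?B x "g (fn f x)" y "g (fn f y)" v] by auto
    qed
  qed
  \<comment> \<open>The way back: \<open>U\<close> gives an atom of \<open>W\<close> over the
    saturation of \<open>B\<close> at the chosen points; gluing moves it to the original points, and
    restriction brings it down to \<open>B\<close>.\<close>
  moreover have "pullc f U \<subseteq> W"
  proof
    fix \<alpha> assume \<alpha>: "\<alpha> \<in> pullc f U"
    show "\<alpha> \<in> W"
    proof (cases \<alpha>)
      case (Mark x)
      then have "x \<in> X" "Mark (g (fn f x)) \<in> W"
        using \<alpha> by (auto simp: X_def)
      moreover have "fn f x \<in> vrange f"
        using \<open>x \<in> X\<close> by (auto simp: vrange_def X_def)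
      ultimately show ?thesis
        using Mark N'[of X x] g(1) W.mark_glue[OF _ W.glue_sym, of "g (fn f x)" X x] by auto
    next
      case (Glue B x y)
      let ?B = "P (fn f ` B)"
      from Glue have B: "B \<subseteq> X" "x \<in> B" "y \<in> B"
        using \<alpha> by (auto simp: X_def)
      then have "Glue ?B (g (fn f x)) (g (fn f y)) \<in> W" 
        using Glue \<alpha> rgX[OF B(1)] by auto
      moreover have "Glue ?B x (g (fn f x)) \<in> W" "Glue ?B y (g (fn f y)) \<in> W"
        using B by (auto intro: NP)
      ultimately have "Glue ?B x y \<in> W"
        by (meson W.glue_trans[of ?B x "g (fn f x)"] W.glue_trans[of ?B "g (fn f x)"] W.glue_sym[of ?B y])
      then show ?thesis
        using Glue B W.glue_restrict[of ?B x y B] by (auto simp: P_def)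
    next
      case (Bound B x y v)
      let ?B = "P (fn f ` B)"
      from Bound have B: "B \<subseteq> X" "x \<in> B" "y \<in> B"
        using \<alpha> by (auto simp: X_def)
      then have "Bound ?B (g (fn f x)) (g (fn f y)) v \<in> W" 
        using Bound \<alpha> rgX[OF B(1)] by auto
      moreover have "Glue ?B x (g (fn f x)) \<in> W" "Glue ?B y (g (fn f y)) \<in> W"
        using B by (auto intro: NP)
      ultimately have "Bound ?B x y v \<in> W"
        using W.bound_glue_cong[OF comm_monoid_axioms W.glue_sym W.glue_sym, of ?B x "g (fn f x)" y] 
        by simp
      then show ?thesis
        using Bound B W.bound_restrict[of ?B x y v B] by (auto simp: P_def)
    qed
  qed
  ultimately show ?thesis by blast
qed

lemma gen_upper: "R \<subseteq> gen A R"
  unfolding gen_def by blast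

lemma pullc_mono: "S \<subseteq> T \<Longrightarrow> pullc f S \<subseteq> pullc f T"
  by (auto simp: pullc_def)

text \<open>Let \<open>?W\<close> be the join. Its saturated cluster \<open>U\<close> over the
  target contains \<open>pushc f T\<close> and pulls back into \<open>?W\<close>, which bounds the
  left side. The converse is the adjunction together with the minimality of
  \<open>?W\<close>.\<close>

lemma pullc_pushc:
  assumes f: "mor f" and T: "clus (src f) T"
  shows "pullc f (pushc f T) = gen (src f) (T \<union> kerc f)"
proof
  let ?W = "gen (src f) (T \<union> kerc f)"
  have P: "clus (tgt f) (pushc f T)"
    by (rule cluster_pushc[OF assms])
  have W: "clus (src f) ?W"
    using cluster_subset_top[OF T] cluster_subset_top[OF cluster_kerc[OF f]]
    by (intro cluster_gen morD(1)[OF f]) auto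
  have TW: "T \<union> kerc f \<subseteq> ?W"
    by (rule gen_upper)
  have "kerc f \<subseteq> ?W"
    using TW by simp
  from ex_saturated_cluster[OF f W this]
  obtain U where U: "clus (tgt f) U" "atom_map (fn f) ` ?W \<subseteq> U" "pullc f U \<subseteq> ?W"
    by (elim exE conjE)
  have "pushc f T \<subseteq> U"
    unfolding pushc_def gen_subset_iff[OF U(1)] using U(2) TW by (meson image_mono le_sup_iff order_trans)
  then have "pullc f (pushc f T) \<subseteq> pullc f U"
    by (rule pullc_mono)
  then show "pullc f (pushc f T) \<subseteq> ?W"
    using U(3) by (rule order_trans)
  have "kerc f \<subseteq> pullc f (pushc f T)"
    unfolding kerc_def using cluster_bot_subset[OF P] by (rule pullc_mono)
  then show "?W \<subseteq> pullc f (pushc f T)"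
    using gen_subset_iff[OF cluster_pullc[OF f P]] pushc_subset_iff[OF T P] by simp
qed


section \<open>The category\<close>

lemma cluster_eqI:
  assumes "clus A S" "clus A T"
    and "\<And>x. x \<in> pts A \<Longrightarrow> Mark x \<in> S \<longleftrightarrow> Mark x \<in> T"
    and "\<And>B x y. \<lbrakk>B \<subseteq> pts A; x \<in> B; y \<in> B\<rbrakk> \<Longrightarrow> Glue B x y \<in> S \<longleftrightarrow> Glue B x y \<in> T"
    and "\<And>B x y v. \<lbrakk>B \<subseteq> pts A; x \<in> B; y \<in> B\<rbrakk> \<Longrightarrow> Bound B x y v \<in> S \<longleftrightarrow> Bound B x y v \<in> T"
  shows "S = T"
proof (rule Set.set_eqI)
  fix \<alpha>
  show "\<alpha> \<in> S \<longleftrightarrow> \<alpha> \<in> T"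
  proof (cases "atom_on (pts A) \<alpha>")
    case True
    then show ?thesis
      by (cases \<alpha>) (use assms(3-5) in auto)
  qed (use cluster.on[OF assms(1)] cluster.on[OF assms(2)] in blast)
qed

text \<open>The part of \<open>W\<close> over the whole of \<open>A\<close> is an equivalence
  relation with an invariant structure. The quotient has class representatives as points, so it
  stays a small set of type \<open>'u\<close>; its value \<open>c x y\<close> is the greatest bound,
  which is attained by \<open>bound_Sup\<close>.\<close>

lemma ex_quotient_by_cluster:
  fixes A :: "('u :: universe, 'v) vcat"
  assumes A: "obj A" and W: "clus A W"
  shows "\<exists>h. mor h \<and> src h = A \<and>
    (\<forall>x\<in>pts A. \<forall>y\<in>pts A. fn h x = fn h y \<longleftrightarrow> Glue (pts A) x y \<in> W) \<and>
    (\<forall>x\<in>pts A. \<forall>y\<in>pts A. \<forall>v. v \<le> vhom (tgt h) (fn h x, fn h y) \<longleftrightarrow> Bound (pts A) x y v \<in> W)"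
proof -
  interpret W: cluster tensor k symm A W by fact
  define X where "X = pts A"
  define c where "c x y = Sup {v. Bound X x y v \<in> W}" for x y
  define r where "r x = (SOME y. Glue X x y \<in> W)" for x
  have r: "Glue X x (r x) \<in> W" if "x \<in> X" for x
    unfolding r_def using W.glue_refl[of X x] that by (intro someI) (auto simp: X_def)
  have GX: "x \<in> X" "y \<in> X" if "Glue X x y \<in> W" for x y
    using W.on[OF that] by auto
  have rX: "r x \<in> X" if "x \<in> X" for x
    using GX(2)[OF r[OF that]] .
  have r_eq: "r x = r y \<longleftrightarrow> Glue X x y \<in> W" if "x \<in> X" "y \<in> X" for x y
  proof
    assume "r x = r y"
    then show "Glue X x y \<in> W"
      using W.glue_trans[OF r[OF that(1)]] W.glue_sym[OF r[OF that(2)]] by simp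
  next
    assume "Glue X x y \<in> W"
    \<comment> \<open>Equivalent points define the same predicate, so \<open>SOME\<close> returns
      the same representative for both.\<close>
    then have "Glue X x z \<in> W \<longleftrightarrow> Glue X y z \<in> W" for z
      using W.glue_trans W.glue_sym by meson
    then show "r x = r y"
      by (simp add: r_def)
  qed
  have c: "v \<le> c x y \<longleftrightarrow> Bound X x y v \<in> W" if "x \<in> X" "y \<in> X" for x y v
  proof
    have "Bound X x y (c x y) \<in> W"
      unfolding c_def using that by (intro W.bound_Sup) (auto simp: X_def)
    then show "v \<le> c x y \<Longrightarrow> Bound X x y v \<in> W"
      by (rule W.bound_down)
  qed (auto simp: c_def intro: Sup_upper)
  have c_r: "v \<le> c (r x) (r y) \<longleftrightarrow> Bound X x y v \<in> W" if "x \<in> X" "y \<in> X" for x y v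
    using c[OF rX[OF that(1)] rX[OF that(2)]]
      W.bound_glue_cong[OF comm_monoid_axioms r[OF that(1)] r[OF that(2)]]
      W.bound_glue_cong[OF comm_monoid_axioms W.glue_sym[OF r[OF that(1)]] W.glue_sym[OF r[OF that(2)]]]
    by blast
  define Q where "Q = \<lparr>pts = r ` X, vhom = restrict (\<lambda>(x, y). c x y) (r ` X \<times> r ` X)\<rparr>"
  define h where "h = \<lparr>src = A, tgt = Q, fn = restrict r X\<rparr>"
  have rr: "r ` X \<subseteq> X"
    using rX by blast
  have "is_vcat tensor k Q"
    unfolding is_vcat_def
  proof (intro conjI ballI)
    show "pts Q \<prec> (UNIV :: 'u set)"
      using small_subset[OF objD(5)[OF A], of "r ` X"] rr by (simp add: Q_def X_def)
    show "vhom Q \<in> pts Q \<times> pts Q \<rightarrow>\<^sub>E UNIV"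
      by (simp add: Q_def PiE_iff)
    show "k \<le> vhom Q (x, x)" if "x \<in> pts Q" for x
      using that rr c[of x x k] W.glue_bound[OF W.glue_refl[of X x]] by (auto simp: Q_def X_def)
    fix x y z assume xyz: "x \<in> pts Q" "y \<in> pts Q" "z \<in> pts Q"
    then have X: "x \<in> X" "y \<in> X" "z \<in> X"
      using rr by (auto simp: Q_def)
    have "Bound X x z (c x y \<otimes> c y z) \<in> W"
      using c[OF X(1,2), of "c x y"] c[OF X(2,3), of "c y z"] by (intro W.bound_trans) auto
    then show "vhom Q (x, y) \<otimes> vhom Q (y, z) \<le> vhom Q (x, z)"
      using xyz c[OF X(1,3)] by (simp add: Q_def)
  qed
  moreover have "symmetric_vcat Q" if symm
  proof -
    have "c x y = c y x" if "x \<in> X" "y \<in> X" for x y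
      unfolding c_def using W.bound_sym[OF \<open>symm\<close>] by (intro arg_cong[of _ _ Sup]) blast
    then show ?thesis
      using rr by (auto simp: symmetric_vcat_def Q_def)
  qed
  ultimately have Q: "obj Q"
    by (simp add: obj_def)
  have "mor h"
    unfolding mor_def is_vfunctor_def
  proof (intro conjI ballI)
    show "vhom (src h) (x, y) \<le> vhom (tgt h) (fn h x, fn h y)"
      if "x \<in> pts (src h)" "y \<in> pts (src h)" for x y
      using that c_r[of x y "vhom A (x, y)"] W.bound_vhom[of X x y] by (auto simp: h_def Q_def X_def)
  qed (use A Q in \<open>auto simp: h_def Q_def X_def obj_def\<close>)
  then show ?thesis
    using r_eq c_r by (intro exI[of _ h]) (auto simp: h_def Q_def X_def)
qed

text \<open>Take \<open>h\<close> to be the quotient by the part of the join over the whole object.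
  Its kernel contains both kernels because a kernel is determined by that part, and it lies in the
  join because clusters are closed under restriction.\<close>

lemma ex_join_kerc:
  assumes f: "mor f" and g: "mor g" and fg: "src g = src f"
  shows "\<exists>h. mor h \<and> src h = src f \<and> kerc h = gen (src f) (kerc f \<union> kerc g)"
proof -
  let ?A = "src f" and ?X = "pts (src f)"
  let ?W = "gen ?A (kerc f \<union> kerc g)"
  have W: "clus ?A ?W"
    using cluster_subset_top[OF cluster_kerc[OF f]] cluster_subset_top[OF cluster_kerc[OF g]]
    by (intro cluster_gen morD(1)[OF f]) (auto simp: fg)
  then interpret W: cluster tensor k symm ?A ?W .
  obtain h where h: "mor h" "src h = ?A"
    and eq: "\<And>x y. x \<in> ?X \<Longrightarrow> y \<in> ?X \<Longrightarrow> fn h x = fn h y \<longleftrightarrow> Glue ?X x y \<in> ?W"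
    and le: "\<And>x y v. x \<in> ?X \<Longrightarrow> y \<in> ?X \<Longrightarrow>
      v \<le> vhom (tgt h) (fn h x, fn h y) \<longleftrightarrow> Bound ?X x y v \<in> ?W"
    using ex_quotient_by_cluster[OF morD(1)[OF f] W] by auto
  have up: "\<alpha> \<in> ?W" if "\<alpha> \<in> kerc f \<union> kerc g" for \<alpha>
    using that gen_upper by blast
  have "kerc f \<union> kerc g \<subseteq> kerc h"
  proof
    fix \<alpha> assume \<alpha>: "\<alpha> \<in> kerc f \<union> kerc g"
    show "\<alpha> \<in> kerc h"
    proof (cases \<alpha>)
      case (Mark x)
      then show ?thesis
        using \<alpha> mem_kerc(1)[OF f] mem_kerc(1)[OF g] by simp
    next
      case (Glue B x y)
      then have "Glue ?X x y \<in> kerc f \<union> kerc g" "B \<subseteq> ?X" "x \<in> B" "y \<in> B"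
        using \<alpha> by (auto simp: mem_kerc f g fg)
      then show ?thesis
        using Glue up[of "Glue ?X x y"] eq[of x y] by (auto simp: mem_kerc h)
    next
      case (Bound B x y v)
      then have "Bound ?X x y v \<in> kerc f \<union> kerc g" "B \<subseteq> ?X" "x \<in> B" "y \<in> B"
        using \<alpha> by (auto simp: mem_kerc f g fg)
      then show ?thesis
        using Bound up[of "Bound ?X x y v"] le[of x y v] by (auto simp: mem_kerc h)
    qed
  qed
  then have "?W \<subseteq> kerc h"
    using gen_subset_iff[OF cluster_kerc[OF h(1)]] h(2) by simp
  moreover have "kerc h \<subseteq> ?W"
  proof
    fix \<alpha> assume \<alpha>: "\<alpha> \<in> kerc h"
    show "\<alpha> \<in> ?W"
    proof (cases \<alpha>)
      case (Mark x)
      then show ?thesis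
        using \<alpha> mem_kerc(1)[OF h(1)] by simp
    next
      case (Glue B x y)
      then show ?thesis
        using \<alpha> eq[of x y] W.glue_restrict[of ?X x y B] by (auto simp: mem_kerc h)
    next
      case (Bound B x y v)
      then show ?thesis
        using \<alpha> le[of x y v] W.bound_restrict[of ?X x y v B] by (auto simp: mem_kerc h)
    qed
  qed
  ultimately show ?thesis
    using h by blast
qed

section \<open>The category and its two factorization properties\<close>

abbreviation cat :: "(('u :: universe, 'v) vcat, ('u, 'v) vfunctor) category" where
  "cat \<equiv> full_subcategory (V_Cat tensor k) (\<lambda>A. symm \<longrightarrow> symmetric_vcat A)"

definition idf :: "('u, 'v) vcat \<Rightarrow> ('u, 'v) vfunctor" where
  "idf A = \<lparr>src = A, tgt = A, fn = (\<lambda>x\<in>pts A. x)\<rparr>"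

definition compf :: "('u, 'v) vfunctor \<Rightarrow> ('u, 'v) vfunctor \<Rightarrow> ('u, 'v) vfunctor" where
  "compf g f = \<lparr>src = src f, tgt = tgt g, fn = compose (pts (src f)) (fn g) (fn f)\<rparr>"

lemma idf_simps [simp]:
  "src (idf A) = A" "tgt (idf A) = A" "x \<in> pts A \<Longrightarrow> fn (idf A) x = x"
  by (simp_all add: idf_def)

lemma compf_simps [simp]:
  "src (compf g f) = src f" "tgt (compf g f) = tgt g"
  "x \<in> pts (src f) \<Longrightarrow> fn (compf g f) x = fn g (fn f x)"
  by (simp_all add: compf_def compose_def)

lemma cat_simps [simp]:
  "Ob cat = Collect obj" "Mor cat = Collect mor" "Dom cat = src" "Cod cat = tgt"
  "Id cat = idf" "Comp cat = compf"
  unfolding full_subcategory_def V_Cat_def obj_def mor_def idf_def[abs_def] compf_def[abs_def]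
    is_vfunctor_def
  by auto

lemma Hom_cat: "f \<in> Hom cat A B \<longleftrightarrow> mor f \<and> src f = A \<and> tgt f = B"
  by (simp add: Hom_def)

lemma morI:
  assumes "obj (src f)" "obj (tgt f)" "fn f \<in> extensional (pts (src f))"
    and "\<And>x. x \<in> pts (src f) \<Longrightarrow> fn f x \<in> pts (tgt f)"
    and "\<And>x y. x \<in> pts (src f) \<Longrightarrow> y \<in> pts (src f) \<Longrightarrow>
      vhom (src f) (x, y) \<le> vhom (tgt f) (fn f x, fn f y)"
  shows "mor f"
  unfolding mor_def is_vfunctor_def using assms by (auto simp: obj_def PiE_iff)

lemma mor_eqI:
  assumes "mor f" "mor g" "src f = src g" "tgt f = tgt g"
    and "\<And>x. x \<in> pts (src f) \<Longrightarrow> fn f x = fn g x"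
  shows "f = g"
proof -
  have "fn f = fn g"
    using assms morD(4) by (metis extensionalityI)
  then show ?thesis
    using assms by (intro vfunctor.equality) auto
qed

lemma mor_idf: "obj A \<Longrightarrow> mor (idf A)"
  by (rule morI) (auto simp: idf_def)

lemma mor_compf:
  assumes "mor f" "mor g" "src g = tgt f"
  shows "mor (compf g f)"
proof (rule morI)
  show "vhom (src (compf g f)) (x, y) \<le> vhom (tgt (compf g f)) (fn (compf g f) x, fn (compf g f) y)"
    if "x \<in> pts (src (compf g f))" "y \<in> pts (src (compf g f))" for x y
    using that morD(5)[OF assms(1), of x y] morD(5)[OF assms(2), of "fn f x" "fn f y"]
      morD(3)[OF assms(1)] assms(3) by (auto intro: order_trans)
  show "fn (compf g f) \<in> extensional (pts (src (compf g f)))"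
    by (simp add: compf_def)
qed (use assms in \<open>auto simp: morD\<close>)

lemma category_cat: "category cat"
proof
  show "Id cat X \<in> Hom cat X X" if "X \<in> Ob cat" for X
    using that by (simp add: Hom_cat mor_idf)
qed (auto simp: Hom_cat morD mor_idf mor_compf intro!: mor_eqI)

text \<open>The lift is computed pointwise by inverting \<open>i\<close> on its range. Full
  faithfulness makes it a morphism, and injectivity makes it unique.\<close>

lemma factor_through_injective:
  assumes i: "mor i" "injective i" "fully_faithful i"
    and f: "mor f" "tgt f = tgt i" "vrange f \<subseteq> vrange i"
  shows "\<exists>!h. h \<in> Hom cat (src f) (src i) \<and> f = compf i h"
proof (rule ex_ex1I)
  define s where "s x = inv_into (pts (src i)) (fn i) (fn f x)" for x
  have s: "s x \<in> pts (src i)" "fn i (s x) = fn f x" if "x \<in> pts (src f)" for x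
  proof -
    have "fn f x \<in> fn i ` pts (src i)"
      using that f(3) by (auto simp: vrange_def)
    then show "s x \<in> pts (src i)" "fn i (s x) = fn f x"
      by (simp_all add: s_def inv_into_into f_inv_into_f)
  qed
  define h where "h = \<lparr>src = src f, tgt = src i, fn = restrict s (pts (src f))\<rparr>"
  have "mor h"
  proof (rule morI)
    show "vhom (src h) (x, y) \<le> vhom (tgt h) (fn h x, fn h y)"
      if "x \<in> pts (src h)" "y \<in> pts (src h)" for x y
      using that s[of x] s[of y] i(3) morD(5)[OF f(1), of x y] f(2)
      by (simp add: h_def fully_faithful_def)
  qed (use s in \<open>auto simp: h_def morD[OF f(1)] morD[OF i(1)]\<close>)
  moreover have "f = compf i h"
    using f s \<open>mor h\<close> i by (intro mor_eqI mor_compf) (auto simp: h_def)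
  moreover have "h \<in> Hom cat (src f) (src i)"
    using \<open>mor h\<close> by (simp add: Hom_cat h_def)
  ultimately show "\<exists>h. h \<in> Hom cat (src f) (src i) \<and> f = compf i h"
    by blast
next
  fix h h'
  assume h: "h \<in> Hom cat (src f) (src i) \<and> f = compf i h"
    and h': "h' \<in> Hom cat (src f) (src i) \<and> f = compf i h'"
  have hh: "mor h" "src h = src f" "tgt h = src i" "mor h'" "src h' = src f" "tgt h' = src i"
    using conjunct1[OF h] conjunct1[OF h'] by (simp_all add: Hom_cat)
  have eq: "compf i h = compf i h'"
    using conjunct2[OF h] conjunct2[OF h'] by (rule trans[OF sym])
  show "h = h'"
  proof (rule mor_eqI)
    fix x assume x: "x \<in> pts (src h)"
    from eq have "fn (compf i h) x = fn (compf i h') x"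
      by (rule arg_cong)
    then have "fn i (fn h x) = fn i (fn h' x)"
      using x by (simp add: hh)
    moreover have "fn h x \<in> pts (src i)" "fn h' x \<in> pts (src i)"
      using x morD(3)[of h x] morD(3)[of h' x] by (simp_all add: hh)
    ultimately show "fn h x = fn h' x"
      using i(2) unfolding injective_def by (meson inj_onD)
  qed (simp_all add: hh)
qed

text \<open>Read over the whole source, the inclusion of kernels says that \<open>g\<close> is
  constant on the fibres of \<open>p\<close> and that its values dominate those of \<open>p\<close>.
  So \<open>g\<close> composed with any section of \<open>p\<close> is a morphism, and surjectivity
  makes it unique.\<close>

lemma factor_through_surjective:
  assumes p: "mor p" "surjective p"
    and g: "mor g" "src g = src p" "kerc p \<subseteq> kerc g"
  shows "\<exists>!h. h \<in> Hom cat (tgt p) (tgt g) \<and> g = compf h p"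
proof (rule ex_ex1I)
  let ?X = "pts (src p)"
  have eq: "fn g x = fn g y" if "x \<in> ?X" "y \<in> ?X" "fn p x = fn p y" for x y
    using that g(3) mem_kerc(2)[OF p(1), of ?X x y] mem_kerc(2)[OF g(1), of ?X x y] by auto
  have le: "vhom (tgt p) (fn p x, fn p y) \<le> vhom (tgt g) (fn g x, fn g y)"
    if "x \<in> ?X" "y \<in> ?X" for x y
    using that g(3) mem_kerc(3)[OF p(1), of ?X x y] mem_kerc(3)[OF g(1), of ?X x y] by auto
  define s where "s = inv_into ?X (fn p)"
  have s: "s y \<in> ?X" "fn p (s y) = y" if "y \<in> pts (tgt p)" for y
    using that p(2) unfolding s_def surjective_def by (metis inv_into_into, metis f_inv_into_f)
  define h where "h = \<lparr>src = tgt p, tgt = tgt g, fn = restrict (\<lambda>y. fn g (s y)) (pts (tgt p))\<rparr>"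
  have "mor h"
  proof (rule morI)
    show "vhom (src h) (x, y) \<le> vhom (tgt h) (fn h x, fn h y)"
      if "x \<in> pts (src h)" "y \<in> pts (src h)" for x y
      using that s[of x] s[of y] le[of "s x" "s y"] by (simp add: h_def)
  qed (use s g in \<open>auto simp: h_def morD[OF g(1)] morD[OF p(1)]\<close>)
  moreover have "g = compf h p"
  proof (rule mor_eqI)
    fix x assume "x \<in> pts (src g)"
    then have "x \<in> ?X" "fn p x \<in> pts (tgt p)"
      using g(2) morD(3)[OF p(1), of x] by auto
    then show "fn g x = fn (compf h p) x"
      using s[of "fn p x"] eq[of x "s (fn p x)"] by (simp add: h_def)
  qed (use g p \<open>mor h\<close> in \<open>auto intro!: mor_compf simp: h_def\<close>)
  moreover have "h \<in> Hom cat (tgt p) (tgt g)"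
    using \<open>mor h\<close> by (simp add: Hom_cat h_def)
  ultimately show "\<exists>h. h \<in> Hom cat (tgt p) (tgt g) \<and> g = compf h p"
    by blast
next
  fix h h'
  assume h: "h \<in> Hom cat (tgt p) (tgt g) \<and> g = compf h p"
    and h': "h' \<in> Hom cat (tgt p) (tgt g) \<and> g = compf h' p"
  have hh: "mor h" "src h = tgt p" "tgt h = tgt g" "mor h'" "src h' = tgt p" "tgt h' = tgt g"
    using conjunct1[OF h] conjunct1[OF h'] by (simp_all add: Hom_cat)
  have eq: "compf h p = compf h' p"
    using conjunct2[OF h] conjunct2[OF h'] by (rule trans[OF sym])
  show "h = h'"
  proof (rule mor_eqI)
    fix y assume "y \<in> pts (src h)"
    then obtain x where x: "x \<in> pts (src p)" "y = fn p x"
      using hh p(2) by (auto simp: surjective_def)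
    from eq have "fn (compf h p) x = fn (compf h' p) x"
      by (rule arg_cong)
    then show "fn h y = fn h' y"
      using x by simp
  qed (simp_all add: hh)
qed

section \<open>Full subobjects, corestrictions and the order of images\<close>

definition subobj :: "('u, 'v) vcat \<Rightarrow> 'u set \<Rightarrow> ('u, 'v) vcat" where
  "subobj A S = \<lparr>pts = S, vhom = restrict (vhom A) (S \<times> S)\<rparr>"

definition incl :: "('u, 'v) vcat \<Rightarrow> 'u set \<Rightarrow> ('u, 'v) vfunctor" where
  "incl A S = \<lparr>src = subobj A S, tgt = A, fn = (\<lambda>x\<in>S. x)\<rparr>"

definition corestr :: "('u :: universe, 'v) vfunctor \<Rightarrow> ('u, 'v) vfunctor" where
  "corestr f = \<lparr>src = src f, tgt = subobj (tgt f) (vrange f), fn = fn f\<rparr>"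

lemma obj_subobj:
  fixes A :: "('u :: universe, 'v) vcat"
  assumes A: "obj A" and S: "S \<subseteq> pts A"
  shows "obj (subobj A S)"
proof -
  have "pts (subobj A S) \<prec> (UNIV :: 'u set)"
    using small_subset[OF objD(5)[OF A] S] by (simp add: subobj_def)
  then show ?thesis
    unfolding obj_def is_vcat_def symmetric_vcat_def
    using S objD(1,2,3)[OF A] by (auto simp: subobj_def PiE_iff subset_iff)
qed

lemma incl:
  assumes "obj A" "S \<subseteq> pts A"
  shows "mor (incl A S)" "injective (incl A S)" "fully_faithful (incl A S)" "vrange (incl A S) = S"
    and "src (incl A S) = subobj A S" "tgt (incl A S) = A"
proof -
  show "mor (incl A S)"
    using assms obj_subobj[OF assms] by (intro morI) (auto simp: incl_def subobj_def)
qed (auto simp: incl_def subobj_def injective_def fully_faithful_def vrange_def inj_on_def)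

text \<open>This is the factorization through the range. The structure on the range is restricted
  from the target, so corestriction changes neither the equality of values nor the structure between
  them, and the kernel stays the same.\<close>

lemma corestr:
  assumes "mor f"
  shows "mor (corestr f)" "surjective (corestr f)" "kerc (corestr f) = kerc f"
    and "src (corestr f) = src f" "tgt (corestr f) = subobj (tgt f) (vrange f)"
    and "compf (incl (tgt f) (vrange f)) (corestr f) = f"
proof -
  have O: "obj (subobj (tgt f) (vrange f))"
    using assms by (intro obj_subobj morD(2) vrange_subset)
  show m: "mor (corestr f)"
    using O by (intro morI) (auto simp: corestr_def subobj_def vrange_def morD[OF assms])
  have s: "src (corestr f) = src f" "fn (corestr f) = fn f"
    by (simp_all add: corestr_def)
  have vhom: "vhom (tgt (corestr f)) (fn f x, fn f y) = vhom (tgt f) (fn f x, fn f y)"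
    if "x \<in> pts (src f)" "y \<in> pts (src f)" for x y
    using that by (simp add: corestr_def subobj_def vrange_def)
  show "kerc (corestr f) = kerc f"
  proof (rule cluster_eqI[of "src f"])
    show "clus (src f) (kerc (corestr f))"
      using cluster_kerc[OF m] s by simp
  qed (use cluster_kerc[OF assms] in \<open>auto simp: mem_kerc m assms s vhom subset_iff\<close>)
  show "compf (incl (tgt f) (vrange f)) (corestr f) = f"
    using assms m incl(1)[OF morD(2)[OF assms] vrange_subset[OF assms]]
    by (intro mor_eqI mor_compf) (auto simp: corestr_def incl_def vrange_def subobj_def)
qed (auto simp: corestr_def surjective_def subobj_def vrange_def)

text \<open>The marks recover the range: over a one-point set the full and the trivial structure may
  coincide, so gluing and bounds alone need not see every point of the range.\<close>

lemma imgc_le_iff: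
  assumes "mor f" "mor g" "tgt f = tgt g"
  shows "imgc f \<subseteq> imgc g \<longleftrightarrow> vrange f \<subseteq> vrange g"
proof
  assume le: "imgc f \<subseteq> imgc g"
  show "vrange f \<subseteq> vrange g"
  proof
    fix y assume "y \<in> vrange f"
    then have "Mark y \<in> imgc f"
      using vrange_subset[OF assms(1)] by (auto simp: imgc_def)
    then have "Mark y \<in> imgc g"
      using le by blast
    then show "y \<in> vrange g"
      by (simp add: imgc_def)
  qed
next
  assume le: "vrange f \<subseteq> vrange g"
  show "imgc f \<subseteq> imgc g"
  proof
    fix \<alpha> assume "\<alpha> \<in> imgc f"
    then show "\<alpha> \<in> imgc g"
      using le assms(3) by (cases \<alpha>) (auto simp: imgc_def)
  qed
qed

text \<open>A set lies in both ranges exactly when it lies in their intersection, and if it misses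
  one range, the meet is already trivial over it.\<close>

lemma imgc_Int: "imgc f \<inter> imgc g = atoms_over (tgt f) (vrange f \<inter> vrange g)" if "tgt f = tgt g"
proof (rule Set.set_eqI)
  fix \<alpha>
  show "\<alpha> \<in> imgc f \<inter> imgc g \<longleftrightarrow> \<alpha> \<in> atoms_over (tgt f) (vrange f \<inter> vrange g)"
    using that by (cases \<alpha>) (auto simp: imgc_def)
qed

section \<open>The proper factorization system\<close>

lemma surjective_epi:
  assumes p: "mor p" "surjective p"
    and h: "mor g" "mor h" "src g = tgt p" "src h = tgt p" "tgt g = tgt h" "compf g p = compf h p"
  shows "g = h"
proof (rule mor_eqI)
  fix y assume "y \<in> pts (src g)"
  then obtain x where x: "x \<in> pts (src p)" "y = fn p x"
    using h(3) p(2) by (auto simp: surjective_def)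
  from h(6) have "fn (compf g p) x = fn (compf h p) x"
    by (rule arg_cong)
  then show "fn g y = fn h y"
    using x by simp
qed (simp_all add: h)

lemma injective_mono:
  assumes i: "mor i" "injective i"
    and h: "mor g" "mor h" "tgt g = src i" "tgt h = src i" "src g = src h" "compf i g = compf i h"
  shows "g = h"
proof (rule mor_eqI)
  fix x assume x: "x \<in> pts (src g)"
  from h(6) have "fn (compf i g) x = fn (compf i h) x"
    by (rule arg_cong)
  then have "fn i (fn g x) = fn i (fn h x)"
    using x h(5) by simp
  moreover have "fn g x \<in> pts (src i)" "fn h x \<in> pts (src i)"
    using x h morD(3)[of g x] morD(3)[of h x] by simp_all
  ultimately show "fn g x = fn h x"
    using i(2) unfolding injective_def by (meson inj_onD)
qed (simp_all add: h)

lemma iso_surjective_injective: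
  assumes f: "mor f" and g: "mor g" "src g = tgt f" "tgt g = src f"
    and gf: "compf g f = idf (src f)" and fg: "compf f g = idf (tgt f)"
  shows "surjective f" "injective f" "fully_faithful f"
proof -
  have gf': "fn g (fn f x) = x" if "x \<in> pts (src f)" for x
    using that arg_cong[OF gf, of "\<lambda>h. fn h x"] by simp
  have fg': "fn f (fn g y) = y" if "y \<in> pts (tgt f)" for y
    using that arg_cong[OF fg, of "\<lambda>h. fn h y"] g by simp
  show "injective f"
    unfolding injective_def using gf' by (metis inj_onI)
  show "surjective f"
    unfolding surjective_def
  proof (intro equalityI subsetI)
    fix y assume "y \<in> pts (tgt f)"
    then show "y \<in> fn f ` pts (src f)"
      using fg'[of y] morD(3)[OF g(1), of y] g by (auto intro!: image_eqI[of y "fn f" "fn g y"])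
  qed (use morD(3)[OF f] in auto)
  show "fully_faithful f"
    unfolding fully_faithful_def
  proof (intro ballI antisym)
    fix x y assume xy: "x \<in> pts (src f)" "y \<in> pts (src f)"
    then show "vhom (src f) (x, y) \<le> vhom (tgt f) (fn f x, fn f y)"
      by (rule morD(5)[OF f])
    show "vhom (tgt f) (fn f x, fn f y) \<le> vhom (src f) (x, y)"
      using morD(5)[OF g(1), of "fn f x" "fn f y"] gf'[OF xy(1)] gf'[OF xy(2)]
        morD(3)[OF f xy(1)] morD(3)[OF f xy(2)] g by simp
  qed
qed

lemma proper_factorization_system_cat:
  "proper_factorization_system cat {f. mor f \<and> surjective f}
     {f. mor f \<and> injective f \<and> fully_faithful f}"
    (is "proper_factorization_system _ ?E ?M")
proof -
  interpret category cat by (rule category_cat)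
  show ?thesis
  proof
    show "isomorphisms cat \<subseteq> ?E" "isomorphisms cat \<subseteq> ?M"
      using iso_surjective_injective by (auto simp: isomorphisms_def Hom_cat)
    show "Comp cat g f \<in> ?E" if "f \<in> ?E" "g \<in> ?E" "Cod cat f = Dom cat g" for f g
    proof -
      have "fn (compf g f) ` pts (src f) = fn g ` fn f ` pts (src f)"
        by (auto simp: image_image)
      then show ?thesis
        using that by (simp add: mor_compf surjective_def)
    qed
    show "Comp cat g f \<in> ?M" if "f \<in> ?M" "g \<in> ?M" "Cod cat f = Dom cat g" for f g
    proof -
      have "fn f x \<in> pts (src g)" if "x \<in> pts (src f)" for x
        using that morD(3)[of f x] \<open>f \<in> ?M\<close> \<open>Cod cat f = Dom cat g\<close> by simp
      then show ?thesis
        using that by (simp add: mor_compf injective_def inj_on_def fully_faithful_def)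
    qed
    show "\<exists>e\<in>?E. \<exists>m\<in>?M. Cod cat e = Dom cat m \<and> f = Comp cat m e" if "f \<in> Mor cat" for f
    proof -
      have f: "mor f"
        using that by simp
      show ?thesis
        using corestr[OF f] incl[OF morD(2)[OF f] vrange_subset[OF f]]
        by (intro bexI[of _ "corestr f"] bexI[of _ "incl (tgt f) (vrange f)"]) simp_all
    qed
    show "\<exists>!d. d \<in> Hom cat (Cod cat e) (Dom cat m) \<and> Comp cat d e = u \<and> Comp cat m d = v"
      if e: "e \<in> ?E" and m: "m \<in> ?M" and u: "u \<in> Hom cat (Dom cat e) (Dom cat m)"
        and v: "v \<in> Hom cat (Cod cat e) (Cod cat m)" and eq: "Comp cat v e = Comp cat m u" for e m u v
    proof -
      have u': "mor u" "src u = src e" "tgt u = src m" and v': "mor v" "src v = tgt e" "tgt v = tgt m"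
        using u v by (simp_all add: Hom_cat)
      have eq': "fn v (fn e x) = fn m (fn u x)" if "x \<in> pts (src e)" for x
        using that arg_cong[OF eq, of "\<lambda>h. fn h x"] u' by simp
      \<comment> \<open>Every point of the source of \<open>v\<close> has the form
        \<open>fn e x\<close>, and its value under \<open>v\<close> is that of \<open>fn u x\<close>
        under \<open>m\<close>. Thus \<open>v\<close> factors uniquely through \<open>m\<close>,
        which gives the diagonal.\<close>
      have "vrange v \<subseteq> vrange m"
      proof
        fix z assume "z \<in> vrange v"
        then obtain y where y: "y \<in> pts (tgt e)" "z = fn v y"
          using v' by (auto simp: vrange_def)
        moreover from y(1) obtain x where "x \<in> pts (src e)" "y = fn e x"
          using e by (auto simp: surjective_def)
        ultimately have x: "x \<in> pts (src e)" "z = fn v (fn e x)"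
          by simp_all
        from x show "z \<in> vrange m"
          using eq'[of x] morD(3)[OF u'(1), of x] u' by (auto simp: vrange_def)
      qed
      then have ex1: "\<exists>!d. d \<in> Hom cat (tgt e) (src m) \<and> v = compf m d"
        using factor_through_injective[of m v] m v' by simp
      \<comment> \<open>The upper triangle follows by cancelling the monomorphism \<open>m\<close>
        in \<open>m d e = v e = m u\<close>.\<close>
      have "compf d e = u" if d: "d \<in> Hom cat (tgt e) (src m)" and vd: "v = compf m d" for d
      proof (rule injective_mono[of m])
        have d': "mor d" "src d = tgt e" "tgt d = src m"
          using d by (simp_all add: Hom_cat)
        have "compf (compf m d) e = compf m (compf d e)"
          using Comp_assoc[of e "src e" "tgt e" d "src m" m "tgt m"] e m d by (simp add: Hom_cat)
        then show "compf m (compf d e) = compf m u"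
          using eq vd by simp
        show "mor (compf d e)" "tgt (compf d e) = src m" "src (compf d e) = src u"
          using e d' u' by (simp_all add: mor_compf)
      qed (use m u' in simp_all)
      then show ?thesis
        unfolding cat_simps using ex1 by metis
    qed
    show "?E \<subseteq> epimorphisms cat"
    proof
      fix p assume "p \<in> ?E"
      then have p: "mor p" "surjective p" by simp_all
      show "p \<in> epimorphisms cat"
        unfolding epimorphisms_def cat_simps Hom_cat mem_Collect_eq
        by (intro conjI allI ballI impI, simp add: p, rule surjective_epi[OF p]) (simp_all add: Hom_cat)
    qed
    show "?M \<subseteq> monomorphisms cat"
    proof
      fix i assume "i \<in> ?M"
      then have i: "mor i" "injective i" by simp_all
      show "i \<in> monomorphisms cat"
        unfolding monomorphisms_def cat_simps Hom_cat mem_Collect_eq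
        by (intro conjI allI ballI impI, simp add: i, rule injective_mono[OF i]) (simp_all add: Hom_cat)
    qed
  qed auto
qed

section \<open>Smallness of hom-sets and of fibres\<close>

lemma small_Hom:
  fixes A B :: "('u :: universe, 'v) vcat"
  assumes "obj A" "obj B"
  shows "Hom cat A B \<prec> (UNIV :: 'u set)"
proof -
  \<comment> \<open>A morphism between fixed objects is determined by its graph, since its function
    is extensional; graphs are subsets of a small product.\<close>
  let ?gr = "\<lambda>f. (\<lambda>x. (x, fn f x)) ` pts A"
  have "inj_on ?gr (Hom cat A B)"
  proof (rule inj_onI)
    fix f g assume f: "f \<in> Hom cat A B" and g: "g \<in> Hom cat A B" and eq: "?gr f = ?gr g"
    show "f = g"
    proof (rule mor_eqI)
      fix x assume "x \<in> pts (src f)"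
      then have "(x, fn f x) \<in> ?gr g"
        using f eq by (auto simp: Hom_cat)
      then show "fn f x = fn g x" by auto
    qed (use f g in \<open>auto simp: Hom_cat\<close>)
  qed
  note inj = this
  have "?gr ` Hom cat A B \<subseteq> Pow (pts A \<times> pts B)"
    using morD(3) by (fastforce simp: Hom_cat)
  then have "?gr ` Hom cat A B \<prec> (UNIV :: 'u set)"
    by (rule small_subset[OF small_Pow[OF small_Times[OF objD(5)[OF assms(1)] objD(5)[OF assms(2)]]]])
  then show ?thesis
    by (rule lesspoll_image_iff[THEN iffD1, OF inj])
qed

text \<open>A cluster amounts to three relations between points, subsets of \<open>pts A\<close> and
  elements of the quantale. Smallness of \<open>'v\<close> makes the relation that records the
  bounds range over a small set.\<close>

lemma small_clusters:
  fixes A :: "('u :: universe, 'v) vcat"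
  assumes V: "(UNIV :: 'v set) \<prec> (UNIV :: 'u set)" and A: "obj A"
  shows "Collect (clus A) \<prec> (UNIV :: 'u set)"
proof -
  let ?d = "\<lambda>T. ({x. Mark x \<in> T}, {(B, x, y). Glue B x y \<in> T}, {(B, x, y, v). Bound B x y v \<in> T})"
  have "inj_on ?d (Collect (clus A))"
  proof (rule inj_onI)
    fix S T assume c: "S \<in> Collect (clus A)" "T \<in> Collect (clus A)" and "?d S = ?d T"
    then have "{x. Mark x \<in> S} = {x. Mark x \<in> T}"
      and "{(B, x, y). Glue B x y \<in> S} = {(B, x, y). Glue B x y \<in> T}"
      and "{(B, x, y, v). Bound B x y v \<in> S} = {(B, x, y, v). Bound B x y v \<in> T}"
      by simp_all
    then have "Mark x \<in> S \<longleftrightarrow> Mark x \<in> T" "Glue B x y \<in> S \<longleftrightarrow> Glue B x y \<in> T"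
      "Bound B x y v \<in> S \<longleftrightarrow> Bound B x y v \<in> T" for B x y v
      by (auto simp: set_eq_iff)
    then show "S = T"
      using c by (intro cluster_eqI[of A]) simp_all
  qed
  note inj = this
  have sub: "?d ` Collect (clus A) \<subseteq> Pow (pts A) \<times> Pow (Pow (pts A) \<times> pts A \<times> pts A)
      \<times> Pow (Pow (pts A) \<times> pts A \<times> pts A \<times> (UNIV :: 'v set))" (is "_ \<subseteq> ?P")
  proof (intro image_subsetI)
    fix T assume "T \<in> Collect (clus A)"
    then have T: "atom_on (pts A) \<alpha>" if "\<alpha> \<in> T" for \<alpha>
      using cluster.on that by blast
    show "?d T \<in> ?P"
      by (auto dest!: T)
  qed
  have "?P \<prec> (UNIV :: 'u set)"
    by (intro small_Times small_Pow objD(5)[OF A] V)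
  then have "?d ` Collect (clus A) \<prec> (UNIV :: 'u set)"
    using sub by (rule small_subset)
  then show ?thesis
    by (rule lesspoll_image_iff[THEN iffD1, OF inj])
qed

end


section \<open>The form\<close>

text \<open>The clusters of a form have to be elements of the universe, whereas the clusters here
  are sets of atoms. Each fibre is therefore transported along an injection \<open>enc A\<close>
  into \<open>'u\<close>.\<close>

locale encoded_vcat_form = vcat_form tensor k symm
  for tensor :: "'v :: complete_lattice \<Rightarrow> 'v \<Rightarrow> 'v"  (infixl \<open>\<otimes>\<close> 70) and k symm +
  fixes enc :: "('u :: universe, 'v) vcat \<Rightarrow> ('u, 'v) atom set \<Rightarrow> 'u"
  assumes enc_inj: "obj A \<Longrightarrow> inj_on (enc A) (Collect (clus A))"
    and enc_small: "obj A \<Longrightarrow> enc A ` Collect (clus A) \<prec> (UNIV :: 'u set)"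
begin

definition dec :: "('u, 'v) vcat \<Rightarrow> 'u \<Rightarrow> ('u, 'v) atom set" where
  "dec A = inv_into (Collect (clus A)) (enc A)"

definition fib :: "('u, 'v) vcat \<Rightarrow> 'u gorder" where
  "fib A = \<lparr>carrier = enc A ` Collect (clus A), eq = (=), le = (\<lambda>s t. dec A s \<subseteq> dec A t)\<rparr>"

definition vform :: "(('u, 'v) vcat, ('u, 'v) vfunctor, 'u) form" where
  "vform = \<lparr>Fib = fib,
    push = (\<lambda>f s. enc (tgt f) (pushc f (dec (src f) s))),
    pull = (\<lambda>f t. enc (src f) (pullc f (dec (tgt f) t)))\<rparr>"

section \<open>The encoded fibres as bounded lattices\<close>

lemma dec_enc [simp]: "\<lbrakk>obj A; clus A T\<rbrakk> \<Longrightarrow> dec A (enc A T) = T"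
  unfolding dec_def by (intro inv_into_f_f enc_inj) auto

lemma carrierE:
  assumes "s \<in> carrier (fib A)"
  obtains T where "clus A T" "s = enc A T"
  using assms by (auto simp: fib_def)

lemma enc_carrier: "clus A T \<Longrightarrow> enc A T \<in> carrier (fib A)"
  by (simp add: fib_def)

lemma enc_le: "\<lbrakk>obj A; clus A S; clus A T\<rbrakk> \<Longrightarrow> enc A S \<sqsubseteq>\<^bsub>fib A\<^esub> enc A T \<longleftrightarrow> S \<subseteq> T"
  by (simp add: fib_def)

lemma partial_order_fib:
  assumes A: "obj A"
  shows "partial_order (fib A)"
proof
  show "s .=\<^bsub>fib A\<^esub> t" if "s \<sqsubseteq>\<^bsub>fib A\<^esub> t" "t \<sqsubseteq>\<^bsub>fib A\<^esub> s" "s \<in> carrier (fib A)" "t \<in> carrier (fib A)" for s t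
    using that A by (auto elim!: carrierE simp: enc_le) (simp add: fib_def)
qed (auto simp: fib_def)

lemma cluster_gen_Un:
  assumes "obj A" "clus A S" "clus A T"
  shows "clus A (gen A (S \<union> T))"
  using assms cluster_subset_top[of A S] cluster_subset_top[of A T] by (intro cluster_gen) auto

lemma least_join:
  assumes "obj A" "clus A S" "clus A T"
  shows "least (fib A) (enc A (gen A (S \<union> T))) (Upper (fib A) {enc A S, enc A T})"
  using assms cluster_gen_Un[OF assms] gen_upper[of "S \<union> T" A] gen_subset_iff[of A _ "S \<union> T"]
  by (auto simp: least_def Upper_def enc_le enc_carrier elim!: carrierE)

lemma greatest_meet:
  assumes "obj A" "clus A S" "clus A T"
  shows "greatest (fib A) (enc A (S \<inter> T)) (Lower (fib A) {enc A S, enc A T})"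
  using assms cluster_Int[OF assms(2,3)]
  by (auto simp: greatest_def Lower_def enc_le enc_carrier elim!: carrierE)

lemma least_bot:
  assumes "obj A"
  shows "least (fib A) (enc A (bot_cluster A)) (carrier (fib A))"
  using assms cluster_atoms_over[OF assms] cluster_bot_subset[of A]
  by (auto simp: least_def enc_le enc_carrier elim!: carrierE)

lemma greatest_top:
  assumes "obj A"
  shows "greatest (fib A) (enc A (top_cluster A)) (carrier (fib A))"
  using assms cluster_atoms_over[OF assms] cluster_subset_top[of A]
  by (auto simp: greatest_def enc_le enc_carrier elim!: carrierE)

lemma bounded_lattice_fib:
  assumes A: "obj A"
  shows "bounded_lattice (fib A)"
proof -
  interpret partial_order "fib A" by (rule partial_order_fib[OF A])
  show ?thesis
    by standard (use A in \<open>auto elim!: carrierE intro: least_join greatest_meet least_bot greatest_top\<close>)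
qed

text \<open>The lattice operations are defined by choice; in a partial order with true equality
  least and greatest elements are unique, so the choice returns the computed ones.\<close>

lemma fib_ops:
  assumes A: "obj A"
  shows "\<bottom>\<^bsub>fib A\<^esub> = enc A (bot_cluster A)" "\<top>\<^bsub>fib A\<^esub> = enc A (top_cluster A)"
    and "\<lbrakk>clus A S; clus A T\<rbrakk> \<Longrightarrow> enc A S \<squnion>\<^bsub>fib A\<^esub> enc A T = enc A (gen A (S \<union> T))"
    and "\<lbrakk>clus A S; clus A T\<rbrakk> \<Longrightarrow> enc A S \<sqinter>\<^bsub>fib A\<^esub> enc A T = enc A (S \<inter> T)"
proof -
  interpret partial_order "fib A" by (rule partial_order_fib[OF A])
  show "\<bottom>\<^bsub>fib A\<^esub> = enc A (bot_cluster A)"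
    unfolding bottom_def using least_bot[OF A] by (intro some_equality least_unique)
  show "\<top>\<^bsub>fib A\<^esub> = enc A (top_cluster A)"
    unfolding top_def using greatest_top[OF A] by (intro some_equality greatest_unique)
  show "enc A S \<squnion>\<^bsub>fib A\<^esub> enc A T = enc A (gen A (S \<union> T))" if "clus A S" "clus A T"
    unfolding join_def sup_def using least_join[OF A that] by (intro some_equality least_unique)
  show "enc A S \<sqinter>\<^bsub>fib A\<^esub> enc A T = enc A (S \<inter> T)" if "clus A S" "clus A T"
    unfolding meet_def inf_def using greatest_meet[OF A that] by (intro some_equality greatest_unique)
qed

section \<open>Quotients and embeddings of the form, and the noetherian axioms\<close>

lemma vform_simps:
  "Fib vform = fib"
  "\<lbrakk>mor f; clus (src f) T\<rbrakk> \<Longrightarrow> push vform f (enc (src f) T) = enc (tgt f) (pushc f T)"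
  "\<lbrakk>mor f; clus (tgt f) U\<rbrakk> \<Longrightarrow> pull vform f (enc (tgt f) U) = enc (src f) (pullc f U)"
  by (simp_all add: vform_def morD)

lemma Img_vform: "mor f \<Longrightarrow> Img cat vform f = enc (tgt f) (imgc f)"
  unfolding Img_def
  by (simp add: vform_simps fib_ops morD cluster_atoms_over pushc_top)

lemma Ker_vform: "mor f \<Longrightarrow> Ker cat vform f = enc (src f) (kerc f)"
  unfolding Ker_def
  by (simp add: vform_simps fib_ops morD cluster_atoms_over kerc_def)

lemma Img_le_iff:
  assumes "mor f" "mor g" "tgt f = tgt g"
  shows "Img cat vform f \<sqsubseteq>\<^bsub>fib (tgt g)\<^esub> Img cat vform g \<longleftrightarrow> vrange f \<subseteq> vrange g"
  using assms imgc_le_iff[OF assms] cluster_imgc[of f] cluster_imgc[of g]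
  by (simp add: Img_vform enc_le morD)

lemma Ker_le_iff:
  assumes "mor f" "mor g" "src f = src g"
  shows "Ker cat vform f \<sqsubseteq>\<^bsub>fib (src f)\<^esub> Ker cat vform g \<longleftrightarrow> kerc f \<subseteq> kerc g"
  using assms cluster_kerc[of f] cluster_kerc[of g]
  by (simp add: Ker_vform enc_le morD)

lemma quotient_of_Ker:
  assumes p: "mor p" "surjective p"
  shows "quotient_of cat vform (src p) (Ker cat vform p) p"
  unfolding quotient_of_def cat_simps mem_Collect_eq vform_simps(1)
proof (intro conjI ballI impI)
  show "normal cat vform (src p) (Ker cat vform p)"
    using p(1) by (auto simp: normal_def)
  fix g assume "g \<in> Collect mor" and g: "src g = src p \<and> Ker cat vform p \<sqsubseteq>\<^bsub>fib (src p)\<^esub> Ker cat vform g"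
  then have "mor g" by simp
  then show "\<exists>!h. h \<in> Hom cat (tgt p) (tgt g) \<and> g = compf h p"
    using g Ker_le_iff[OF p(1) \<open>mor g\<close>] by (intro factor_through_surjective[OF p]) simp_all
qed (simp_all add: p)

lemma embedding_of_Img:
  assumes i: "mor i" "injective i" "fully_faithful i"
  shows "embedding_of cat vform (tgt i) (Img cat vform i) i"
  unfolding embedding_of_def cat_simps mem_Collect_eq vform_simps(1)
proof (intro conjI ballI impI)
  show "conormal cat vform (tgt i) (Img cat vform i)"
    using i(1) by (auto simp: conormal_def)
  fix f assume "f \<in> Collect mor" and f: "tgt f = tgt i \<and> Img cat vform f \<sqsubseteq>\<^bsub>fib (tgt i)\<^esub> Img cat vform i"
  then have "mor f" by simp
  then show "\<exists>!h. h \<in> Hom cat (src f) (src i) \<and> f = compf i h"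
    using f Img_le_iff[OF \<open>mor f\<close> i(1)] by (intro factor_through_injective[OF i]) simp_all
qed (simp_all add: i)

text \<open>The corestriction \<open>?e\<close> of \<open>p\<close> has the same kernel as
  \<open>p\<close>, so it factors as \<open>h p\<close>. Then \<open>?m h p = p\<close> for the
  inclusion \<open>?m\<close> of the range; uniqueness makes \<open>?m h\<close> the identity, and
  so the range is everything.\<close>

lemma quotient_ofD:
  assumes "quotient_of cat vform A K p"
  shows "mor p" "surjective p" "src p = A" "Ker cat vform p = K"
proof -
  show p: "mor p" "src p = A" and K: "Ker cat vform p = K"
    using assms unfolding quotient_of_def by auto
  have fac: "\<exists>!h. h \<in> Hom cat (tgt p) (tgt g) \<and> g = compf h p"
    if "mor g" "src g = src p" "kerc p \<subseteq> kerc g" for g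
    using that assms p K Ker_le_iff[OF p(1), of g] unfolding quotient_of_def cat_simps vform_simps(1)
    by auto
  let ?e = "corestr p" and ?m = "incl (tgt p) (vrange p)"
  note e = corestr[OF p(1)] and m = incl[OF morD(2)[OF p(1)] vrange_subset[OF p(1)]]
  have "\<exists>!h. h \<in> Hom cat (tgt p) (tgt ?e) \<and> ?e = compf h p"
    by (rule fac) (simp_all add: e)
  then obtain h where h: "h \<in> Hom cat (tgt p) (tgt ?e)" "?e = compf h p"
    by blast
  have h': "mor h" "src h = tgt p" "tgt h = src ?m"
    using h(1) e m by (auto simp: Hom_cat)
  interpret category cat by (rule category_cat)
  have "compf (compf ?m h) p = compf ?m (compf h p)"
    using Comp_assoc[of p "src p" "tgt p" h "src ?m" ?m "tgt p"] p(1) h' m(1,6) by (simp add: Hom_cat)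
  then have "p = compf (compf ?m h) p"
    using e(6) h(2) by simp
  moreover have "p = compf (idf (tgt p)) p"
    using Id_Comp[of p] p(1) by simp
  moreover have "compf ?m h \<in> Hom cat (tgt p) (tgt p)" "idf (tgt p) \<in> Hom cat (tgt p) (tgt p)"
    using h' m p by (auto simp: Hom_cat mor_compf mor_idf morD)
  \<comment> \<open>Both morphisms are factorizations of \<open>p\<close> through \<open>p\<close>
    itself.\<close>
  ultimately have eq: "compf ?m h = idf (tgt p)"
    using fac[of p] p by blast
  have "pts (tgt p) \<subseteq> vrange p"
  proof
    fix y assume y: "y \<in> pts (tgt p)"
    then have "fn ?m (fn h y) = y"
      using arg_cong[OF eq, of "\<lambda>f. fn f y"] h' by simp
    moreover have "fn h y \<in> pts (src ?m)"
      using morD(3)[OF h'(1), of y] h' y by simp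
    ultimately show "y \<in> vrange p"
      by (auto simp: incl_def subobj_def)
  qed
  then show "surjective p"
    using vrange_subset[OF p(1)] by (auto simp: surjective_def vrange_def)
qed

text \<open>Dually, the inclusion of the range of \<open>i\<close> factors as \<open>i h\<close>,
  and uniqueness makes \<open>h\<close> composed with the corestriction \<open>?e\<close> the
  identity. Hence \<open>i\<close> is injective, and since \<open>h\<close> is a morphism on the
  range with the restricted structure, \<open>i\<close> reflects the structure.\<close>

lemma embedding_ofD:
  assumes "embedding_of cat vform A S i"
  shows "mor i" "injective i" "fully_faithful i" "tgt i = A" "Img cat vform i = S"
proof -
  show i: "mor i" "tgt i = A" and S: "Img cat vform i = S"
    using assms unfolding embedding_of_def by auto
  have fac: "\<exists>!h. h \<in> Hom cat (src f) (src i) \<and> f = compf i h"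
    if "mor f" "tgt f = tgt i" "vrange f \<subseteq> vrange i" for f
    using that assms i S Img_le_iff[OF _ i(1), of f]
    unfolding embedding_of_def cat_simps vform_simps(1) by auto
  let ?e = "corestr i" and ?m = "incl (tgt i) (vrange i)"
  note e = corestr[OF i(1)] and m = incl[OF morD(2)[OF i(1)] vrange_subset[OF i(1)]]
  have "\<exists>!h. h \<in> Hom cat (src ?m) (src i) \<and> ?m = compf i h"
    by (rule fac) (simp_all add: m)
  then obtain h where h: "h \<in> Hom cat (src ?m) (src i)" "?m = compf i h"
    by blast
  have h': "mor h" "src h = tgt ?e" "tgt h = src i"
    using h(1) e m by (auto simp: Hom_cat)
  interpret category cat by (rule category_cat)
  have "compf (compf i h) ?e = compf i (compf h ?e)"
    using Comp_assoc[of ?e "src i" "tgt ?e" h "src i" i "tgt i"] i(1) h' e(1,4) by (simp add: Hom_cat)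
  then have "i = compf i (compf h ?e)"
    using e(6) h(2) by simp
  moreover have "i = compf i (idf (src i))"
    using Comp_Id[of i] i(1) by simp
  moreover have "compf h ?e \<in> Hom cat (src i) (src i)" "idf (src i) \<in> Hom cat (src i) (src i)"
    using h' e i by (auto simp: Hom_cat mor_compf mor_idf morD)
  ultimately have eq: "compf h ?e = idf (src i)"
    using fac[of i] i by blast
  have hi: "fn h (fn i x) = x" if "x \<in> pts (src i)" for x
    using arg_cong[OF eq, of "\<lambda>f. fn f x"] that e by (simp add: corestr_def)
  show "injective i"
    unfolding injective_def using hi by (metis inj_onI)
  show "fully_faithful i"
    unfolding fully_faithful_def
  proof (intro ballI antisym)
    fix x y assume xy: "x \<in> pts (src i)" "y \<in> pts (src i)"
    then show "vhom (src i) (x, y) \<le> vhom (tgt i) (fn i x, fn i y)"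
      by (rule morD(5)[OF i(1)])
    show "vhom (tgt i) (fn i x, fn i y) \<le> vhom (src i) (x, y)"
      using morD(5)[OF h'(1), of "fn i x" "fn i y"] hi[OF xy(1)] hi[OF xy(2)] h' xy
      by (simp add: corestr_def subobj_def vrange_def)
  qed
qed

lemma quotients_vform: "quotients cat vform = {f. mor f \<and> surjective f}"
proof (intro Set.set_eqI iffI)
  fix p assume "p \<in> quotients cat vform"
  then show "p \<in> {f. mor f \<and> surjective f}"
    using quotient_ofD unfolding quotients_def by blast
next
  fix p :: "('u, 'v) vfunctor" assume "p \<in> {f. mor f \<and> surjective f}"
  then have p: "mor p" "surjective p" by auto
  then show "p \<in> quotients cat vform"
    unfolding quotients_def using quotient_of_Ker[OF p] morD(1)[OF p(1)] cluster_kerc[OF p(1)]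
    by (auto simp: vform_simps(1) Ker_vform intro!: exI[of _ "src p"] bexI[OF _ enc_carrier])
qed

lemma embeddings_vform: "embeddings cat vform = {f. mor f \<and> injective f \<and> fully_faithful f}"
proof (intro Set.set_eqI iffI)
  fix i assume "i \<in> embeddings cat vform"
  then show "i \<in> {f. mor f \<and> injective f \<and> fully_faithful f}"
    using embedding_ofD unfolding embeddings_def by blast
next
  fix i :: "('u, 'v) vfunctor" assume "i \<in> {f. mor f \<and> injective f \<and> fully_faithful f}"
  then have i: "mor i" "injective i" "fully_faithful i" by auto
  then show "i \<in> embeddings cat vform"
    unfolding embeddings_def using embedding_of_Img[OF i] morD(2)[OF i(1)] cluster_imgc[OF i(1)]
    by (auto simp: vform_simps(1) Img_vform intro!: exI[of _ "tgt i"] bexI[OF _ enc_carrier])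
qed

lemma noetherian_vform:
  assumes "\<And>A B :: ('u, 'v) vcat. obj A \<Longrightarrow> obj B \<Longrightarrow> Hom cat A B \<prec> (UNIV :: 'u set)"
  shows "noetherian_form cat vform"
proof -
  have bl: "weak_partial_order (fib A)" if "obj A" for A
    using partial_order_fib[OF that] by (simp add: partial_order_def)
  show ?thesis
  proof (intro noetherian_form.intro noetherian_form_axioms.intro form.intro form_axioms.intro
      category_cat)
    fix X :: "('u, 'v) vcat" assume "X \<in> Ob cat"
    then have X: "obj X" by simp
    show "carrier (Fib vform X) \<prec> (UNIV :: 'u set)"
      using enc_small[OF X] by (simp add: vform_simps fib_def)
    show "bounded_lattice (Fib vform X)"
      using bounded_lattice_fib[OF X] by (simp add: vform_simps)
    show "Hom cat X Y \<prec> (UNIV :: 'u set)" if "Y \<in> Ob cat" for Y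
      using assms X that by simp
    have idp: "pullc (idf X) T = T" if T: "clus X T" for T
    proof (rule cluster_eqI[of X])
      show "clus X (pullc (idf X) T)"
        using cluster_pullc[OF mor_idf[OF X]] T by simp
      have img: "fn (idf X) ` B = B" if "B \<subseteq> pts X" for B
        using that by (auto simp: idf_def subset_iff image_iff)
      show "Glue B x y \<in> pullc (idf X) T \<longleftrightarrow> Glue B x y \<in> T" if "B \<subseteq> pts X" "x \<in> B" "y \<in> B" for B x y
        using that img[of B] by (simp add: subset_iff)
      show "Bound B x y v \<in> pullc (idf X) T \<longleftrightarrow> Bound B x y v \<in> T"
        if "B \<subseteq> pts X" "x \<in> B" "y \<in> B" for B x y v
        using that img[of B] by (simp add: subset_iff)
    qed (use T in simp_all)
    fix S assume "S \<in> carrier (Fib vform X)"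
    then obtain T where T: "clus X T" "S = enc X T"
      by (auto simp: vform_simps elim: carrierE)
    show "pull vform (Id cat X) S = S"
      using vform_simps(3)[OF mor_idf[OF X]] T idp by simp
    have c: "clus X (pushc (idf X) T)"
      using cluster_pushc[OF mor_idf[OF X], of T] T(1) by simp
    \<comment> \<open>The law for push follows from the law for pull by adjunction: two clusters
      contained in the same clusters are equal.\<close>
    have "pushc (idf X) T \<subseteq> U \<longleftrightarrow> T \<subseteq> U" if "clus X U" for U
      using pushc_subset_iff[of "idf X" T U] T(1) that idp by simp
    from this[OF T(1)] this[OF c] have "pushc (idf X) T = T"
      by (intro equalityI) simp_all
    then show "push vform (Id cat X) S = S"
      using vform_simps(2)[OF mor_idf[OF X], of T] T by simp
  next
    fix f :: "('u, 'v) vfunctor" and X Y assume "f \<in> Hom cat X Y"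
    then have f: "mor f" "src f = X" "tgt f = Y" by (simp_all add: Hom_cat)
    then have XY: "obj X" "obj Y" using morD by auto
    have push: "push vform f (enc X T) = enc Y (pushc f T)" "clus Y (pushc f T)" if "clus X T" for T
      using that f vform_simps(2)[OF f(1)] cluster_pushc[OF f(1)] by simp_all
    have pull: "pull vform f (enc Y U) = enc X (pullc f U)" "clus X (pullc f U)" if "clus Y U" for U
      using that f vform_simps(3)[OF f(1)] cluster_pullc[OF f(1)] by simp_all
    have adj: "pushc f T \<subseteq> U \<longleftrightarrow> T \<subseteq> pullc f U" if "clus X T" "clus Y U" for T U
      using that f pushc_subset_iff by blast
    show "push vform f \<in> carrier (Fib vform X) \<rightarrow> carrier (Fib vform Y)"
      by (auto simp: vform_simps(1) elim!: carrierE simp: push enc_carrier)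
    show "pull vform f \<in> carrier (Fib vform Y) \<rightarrow> carrier (Fib vform X)"
      by (auto simp: vform_simps(1) elim!: carrierE simp: pull enc_carrier)
    have push_mono: "pushc f S \<subseteq> pushc f T" if "clus X S" "clus X T" "S \<subseteq> T" for S T
      using that adj[OF that(1) push(2)[OF that(2)]] adj[OF that(2) push(2)[OF that(2)]] by simp
    show "isotone (Fib vform X) (Fib vform Y) (push vform f)"
      unfolding vform_simps(1)
      by (rule isotoneI[OF bl[OF XY(1)] bl[OF XY(2)]], elim carrierE) (simp add: push enc_le XY push_mono)
    show "isotone (Fib vform Y) (Fib vform X) (pull vform f)"
      unfolding vform_simps(1)
      by (rule isotoneI[OF bl[OF XY(2)] bl[OF XY(1)]], elim carrierE) (simp add: pull enc_le XY pullc_mono)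
    show "push vform f S \<sqsubseteq>\<^bsub>Fib vform Y\<^esub> T \<longleftrightarrow> S \<sqsubseteq>\<^bsub>Fib vform X\<^esub> pull vform f T"
      if "S \<in> carrier (Fib vform X)" "T \<in> carrier (Fib vform Y)" for S T
      using that unfolding vform_simps(1) by (elim carrierE) (simp add: push pull enc_le XY adj)
    \<comment> \<open>\<open>f\<close> is its corestriction followed by the inclusion of its range;
      the first has the kernel of \<open>f\<close>, the second its image.\<close>
    show "\<exists>e m. quotient_of cat vform X (Ker cat vform f) e \<and> embedding_of cat vform Y (Img cat vform f) m
        \<and> Cod cat e = Dom cat m \<and> f = Comp cat m e"
    proof (intro exI conjI)
      let ?m = "incl (tgt f) (vrange f)"
      note e = corestr[OF f(1)] and m = incl[OF morD(2)[OF f(1)] vrange_subset[OF f(1)]]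
      have "Ker cat vform (corestr f) = Ker cat vform f"
        by (simp add: Ker_vform f(1) e)
      then show "quotient_of cat vform X (Ker cat vform f) (corestr f)"
        using quotient_of_Ker[OF e(1,2)] e(4) f(2) by simp
      have "imgc ?m = imgc f"
        by (simp add: imgc_def m)
      then have "Img cat vform ?m = Img cat vform f"
        by (simp add: Img_vform f(1) m)
      then show "embedding_of cat vform Y (Img cat vform f) ?m"
        using embedding_of_Img[OF m(1,2,3)] m(6) f(3) by simp
      show "Cod cat (corestr f) = Dom cat ?m" "f = Comp cat ?m (corestr f)"
        by (simp_all add: e m)
    qed
    show "pull vform f (push vform f S) = S \<squnion>\<^bsub>Fib vform X\<^esub> Ker cat vform f"
      if "S \<in> carrier (Fib vform X)" for S
      using that cluster_kerc[OF f(1)] pullc_pushc[OF f(1)]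
      by (auto simp: vform_simps(1) push pull Ker_vform f fib_ops XY elim!: carrierE)
    show "push vform f (pull vform f T) = T \<sqinter>\<^bsub>Fib vform Y\<^esub> Img cat vform f"
      if "T \<in> carrier (Fib vform Y)" for T
      using that cluster_imgc[OF f(1)] pushc_pullc[OF f(1)]
      by (auto simp: vform_simps(1) push pull Img_vform f fib_ops XY elim!: carrierE)
    fix g :: "('u, 'v) vfunctor" and Z assume "g \<in> Hom cat Y Z"
    then have g: "mor g" "src g = Y" "tgt g = Z" by (simp_all add: Hom_cat)
    then have Z: "obj Z" using morD by auto
    have gf: "mor (compf g f)"
      using f g by (intro mor_compf) simp_all
    have comp: "pullc (compf g f) U = pullc f (pullc g U)" if U: "clus Z U" for U
    proof (rule cluster_eqI[of X])
      show "clus X (pullc (compf g f) U)"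
        using cluster_pullc[OF gf] U f g by simp
      show "clus X (pullc f (pullc g U))"
        using cluster_pullc[OF f(1)] cluster_pullc[OF g(1)] U f g by simp
      have img: "fn (compf g f) ` B = fn g ` fn f ` B" "fn f ` B \<subseteq> pts Y" if "B \<subseteq> pts X" for B
        using that f morD(3)[OF f(1)] by (auto simp: image_image subset_iff)
      show "Glue B x y \<in> pullc (compf g f) U \<longleftrightarrow> Glue B x y \<in> pullc f (pullc g U)"
        if "B \<subseteq> pts X" "x \<in> B" "y \<in> B" for B x y
        using that img[of B] f g by (simp add: subset_iff)
      show "Bound B x y v \<in> pullc (compf g f) U \<longleftrightarrow> Bound B x y v \<in> pullc f (pullc g U)"
        if "B \<subseteq> pts X" "x \<in> B" "y \<in> B" for B x y v
        using that img[of B] f g by (simp add: subset_iff)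
      show "Mark x \<in> pullc (compf g f) U \<longleftrightarrow> Mark x \<in> pullc f (pullc g U)" if "x \<in> pts X" for x
        using that f g morD(3)[OF f(1), of x] by simp
    qed
    show "pull vform (Comp cat g f) T = pull vform f (pull vform g T)" if "T \<in> carrier (Fib vform Z)" for T
    proof -
      obtain U where U: "clus Z U" "T = enc Z U"
        using \<open>T \<in> carrier (Fib vform Z)\<close> by (auto simp: vform_simps elim: carrierE)
      have "clus Y (pullc g U)" 
        using cluster_pullc[OF g(1)] U g by simp
      then show ?thesis
        using vform_simps(3)[OF gf, of U] vform_simps(3)[OF g(1), of U] pull U f g comp by simp
    qed
    show "push vform (Comp cat g f) S = push vform g (push vform f S)" if "S \<in> carrier (Fib vform X)" for S
    proof -
      obtain T where T: "clus X T" "S = enc X T"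
        using \<open>S \<in> carrier (Fib vform X)\<close> by (auto simp: vform_simps elim: carrierE)
      have c: "clus Y (pushc f T)" "clus Z (pushc g (pushc f T))" "clus Z (pushc (compf g f) T)"
        using cluster_pushc[OF f(1)] cluster_pushc[OF g(1)] cluster_pushc[OF gf] T f g by simp_all
      \<comment> \<open>As for identities, the composition law for push is read off from that for
        pull through the adjunctions.\<close>
      have "pushc (compf g f) T \<subseteq> U \<longleftrightarrow> pushc g (pushc f T) \<subseteq> U" if U: "clus Z U" for U
      proof -
        have "clus Y (pullc g U)" 
          using cluster_pullc[OF g(1)] U g by simp
        then show ?thesis
          using pushc_subset_iff[of "compf g f" T U] pushc_subset_iff[of g "pushc f T" U]
            adj[of T "pullc g U"] comp[OF U] U T c f g by simp
      qed
      from this[OF c(2)] this[OF c(3)] have "pushc (compf g f) T = pushc g (pushc f T)"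
        by (intro equalityI) simp_all
      then show ?thesis
        using vform_simps(2)[OF gf, of T] vform_simps(2)[OF g(1), of "pushc f T"] push T f g c by simp
    qed
  next
    fix X :: "('u, 'v) vcat" and K L assume "X \<in> Ob cat" "normal cat vform X K" "normal cat vform X L"
    then obtain f g where f: "mor f" "src f = X" "K = Ker cat vform f"
      and g: "mor g" "src g = X" "L = Ker cat vform g"
      by (auto simp: normal_def)
    have X: "obj X" and k: "clus X (kerc f)" "clus X (kerc g)"
      using f g morD(1)[OF f(1)] cluster_kerc[OF f(1)] cluster_kerc[OF g(1)] by simp_all
    obtain h where h: "mor h" "src h = X" "kerc h = gen X (kerc f \<union> kerc g)"
      using ex_join_kerc[OF f(1) g(1)] f(2) g(2) by auto
    have "K \<squnion>\<^bsub>Fib vform X\<^esub> L = Ker cat vform h"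
      using f g h fib_ops(3)[OF X k] by (simp add: vform_simps(1) Ker_vform)
    then show "normal cat vform X (K \<squnion>\<^bsub>Fib vform X\<^esub> L)"
      using h by (auto simp: normal_def)
  next
    fix X :: "('u, 'v) vcat" and S T assume "X \<in> Ob cat" "conormal cat vform X S" "conormal cat vform X T"
    then obtain f g where f: "mor f" "tgt f = X" "S = Img cat vform f"
      and g: "mor g" "tgt g = X" "T = Img cat vform g"
      by (auto simp: conormal_def)
    have X: "obj X" and i: "clus X (imgc f)" "clus X (imgc g)"
      using f g morD(2)[OF f(1)] cluster_imgc[OF f(1)] cluster_imgc[OF g(1)] by simp_all
    let ?R = "vrange f \<inter> vrange g"
    have "?R \<subseteq> pts X"
      using vrange_subset[OF f(1)] f(2) by auto
    note m = incl[OF X this]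
    \<comment> \<open>An image depends only on the range, so the meet is the image of the inclusion
      of the common part of both ranges.\<close>
    have "S \<sqinter>\<^bsub>Fib vform X\<^esub> T = Img cat vform (incl X ?R)"
      using f g m fib_ops(4)[OF X i] imgc_Int[of f g]
      by (simp add: vform_simps(1) Img_vform imgc_def[of "incl X ?R"])
    then show "conormal cat vform X (S \<sqinter>\<^bsub>Fib vform X\<^esub> T)"
      using m by (auto simp: conormal_def)
  qed
qed

end

lemma ex_noetherian_form:
  fixes tensor :: "'v :: complete_lattice \<Rightarrow> 'v \<Rightarrow> 'v" and k :: 'v and symm :: bool
  assumes "commutative_unital_quantale tensor k"
    and V: "(UNIV :: 'v set) \<prec> (UNIV :: 'u :: universe set)"
  defines "C \<equiv> full_subcategory (V_Cat tensor k) (\<lambda>A. symm \<longrightarrow> symmetric_vcat A)"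
  shows "\<exists>F :: (('u, 'v) vcat, ('u, 'v) vfunctor, 'u) form.
    noetherian_form C F \<and>
    induces C F {f \<in> Mor C. surjective f} {f \<in> Mor C. injective f \<and> fully_faithful f}"
proof -
  interpret commutative_unital_quantale tensor k by fact
  interpret vcat_form tensor k symm ..
  \<comment> \<open>Each fibre over an object injects into \<open>'u\<close> because it is small;
    choice assembles these injections into \<open>enc\<close>.\<close>
  have "\<exists>e :: ('u, 'v) atom set \<Rightarrow> 'u. obj A \<longrightarrow> inj_on e (Collect (clus A))" for A :: "('u, 'v) vcat"
    using small_clusters[OF V, of A] unfolding lesspoll_def lepoll_def by blast
  then obtain enc :: "('u, 'v) vcat \<Rightarrow> ('u, 'v) atom set \<Rightarrow> 'u"
    where enc: "\<And>A. obj A \<Longrightarrow> inj_on (enc A) (Collect (clus A))"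
    by metis
  interpret encoded_vcat_form tensor k symm enc
    by standard (use enc in \<open>simp_all add: lesspoll_image_iff small_clusters[OF V]\<close>)
  have "noetherian_form cat vform"
    using small_Hom by (rule noetherian_vform)
  moreover have "induces cat vform {f \<in> Mor cat. surjective f} {f \<in> Mor cat. injective f \<and> fully_faithful f}"
    unfolding induces_def using proper_factorization_system_cat quotients_vform embeddings_vform by simp
  ultimately show ?thesis
    unfolding C_def by blast
qed

theorem theorem4p26:
  fixes tensor :: "'v :: complete_lattice \<Rightarrow> 'v \<Rightarrow> 'v" and k :: 'v
  assumes "commutative_unital_quantale tensor k"
    and "(UNIV :: 'v set) \<prec> (UNIV :: 'u :: universe set)"
  shows
    "(\<exists>F :: (('u, 'v) vcat, ('u, 'v) vfunctor, 'u) form.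
        noetherian_form (V_Cat tensor k) F \<and>
        induces (V_Cat tensor k) F
          {f \<in> Mor (V_Cat tensor k). surjective f}
          {f \<in> Mor (V_Cat tensor k). injective f \<and> fully_faithful f}) \<and>
     (\<exists>F :: (('u, 'v) vcat, ('u, 'v) vfunctor, 'u) form.
        noetherian_form (Sym_V_Cat tensor k) F \<and>
        induces (Sym_V_Cat tensor k) F
          {f \<in> Mor (Sym_V_Cat tensor k). surjective f}
          {f \<in> Mor (Sym_V_Cat tensor k). injective f \<and> fully_faithful f})"
proof -
  \<comment> \<open>For \<open>symm\<close> equal to \<open>False\<close> the condition on objects
    always holds, and the full subcategory is \<open>V_Cat\<close> itself; \<open>True\<close> gives
    \<open>Sym_V_Cat\<close>.\<close>
  have "full_subcategory (V_Cat tensor k) (\<lambda>_. True) =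
      (V_Cat tensor k :: (('u, 'v) vcat, ('u, 'v) vfunctor) category)"
    by (simp add: full_subcategory_def)
  then show ?thesis
    using ex_noetherian_form[OF assms, of False] ex_noetherian_form[OF assms, of True]
    unfolding Sym_V_Cat_def by simp
qed

end
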